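(* Let $\Omega\subset\mathbb{R}^n$ be a bounded $\mu$-measurable set, where $\mu$ is a lower Ahlfors $\beta$-regular measure in $\Omega$, let $0\le\alpha<\beta$, and let $p$ be a log-Hölder continuous exponent on $\Omega$ such that $1<p_*\le p(x)\le p^*<\beta/\alpha$ for all $x\in\Omega$. Define $q$ and $s$ on $\Omega$ by $$\frac1{q(x)}=\frac1{p(x)}-\frac{\alpha}{\beta},\qquad s(x)=1+\frac{q(x)}{p'(x)}.$$ If $w$ is a weight on $\Omega$ such that $w(\cdot)^{q(\cdot)}\in A_{s_*-\delta}(\Omega)$ for some $\delta$ with $0<\delta<s_*-1$, then there exists a positive constant $C$ such that $$\|w\,M_\alpha f\|_{q(\cdot),\Omega}\le C\,\|w f\|_{p(\cdot),\Omega}$$ for every function $f$ such that $wf\in L^{p(\cdot)}(\Omega)$.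
   Context: $\mu$ is a non-negative Borel regular measure on $\mathbb{R}^n$. $Q=Q(x,l(Q))$ denotes a cube centered at $x$ with side length $l(Q)$ and sides parallel to the coordinate axes. The measure $\mu$ is lower Ahlfors $\beta$-regular in the bounded set $\Omega$ ($\beta>0$ a constant) if there is $c>0$ with $\mu(Q(x,l(Q)))\ge c\,l(Q)^{\beta}$ for every $x\in\Omega$ and every cube $Q=Q(x,l(Q))$ with $0<l(Q)<\mathrm{diam}(\Omega)$. An exponent is a $\mu$-measurable function $p:\Omega\to[1,\infty)$. For a function $t$ on $\Omega$ write $t_*=\inf_\Omega t$, $t^*=\sup_\Omega t$. When $p_*>1$, $p'$ is defined by $1/p(x)+1/p'(x)=1$. An exponent $p$ is log-Hölder continuous if there is $C>0$ with $|p(x)-p(y)|\le C/\log(1/|x-y|)$ for all $x,y\in\Omega$ with $|x-y|\le 1/2$. When $\alpha=0$, $\beta/\alpha$ means $\infty$. For $\mu$-measurable $f$, $\rho_{p(\cdot),\Omega}(f)=\int_\Omega|f(x)|^{p(x)}\,d\mu(x)$ and $\|f\|_{p(\cdot),\Omega}=\inf\{\lambda>0:\rho_{p(\cdot),\Omega}(f/\lambda)\le1\}$. $L^{p(\cdot)}(\Omega)$ is the set of $\mu$-measurable $f$ supported in $\Omega$ with $\|f\|_{p(\cdot),\Omega}<\infty$. Functions on $\Omega$ are extended by $0$ outside $\Omega$. The centered fractional maximal function is $$M_\alpha f(x)=\sup_{\rho>0}\frac{1}{\mu(Q(x,\rho))^{1-\alpha/\beta}}\int_{Q(x,\rho)}|f(y)|\,d\mu(y).$$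 A weight on $\Omega$ is a $\mu$-measurable function $w$ with $0<w<\infty$ $\mu$-a.e. For $1<\sigma<\infty$, a weight $v$ belongs to $A_\sigma(\Omega)$ if there is $C>0$ with $$\Big(\frac1{\mu(Q)}\int_{Q\cap\Omega}v\,d\mu\Big)\Big(\frac1{\mu(Q)}\int_{Q\cap\Omega}v^{-1/(\sigma-1)}\,d\mu\Big)^{\sigma-1}\le C$$ for each cube $Q$ centered at a point of $\Omega$.
   Formalization: The formal theorem additionally assumes that μ(Q) is finite for every cube Q centered at a point of Ω, so that the averages in the maximal function and in the A_σ condition make sense; without this the averages are undefined, and with 1/∞=0 the claim fails. *)

theory Defs
  imports "HOL-Analysis.Analysis"
begin

text \<open>
  A (nonnegative) Borel regular measure on R^n.  The \<open>\<mu>\<close>-measurable sets are those of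
  \<^term>\<open>sets \<mu>\<close>, which may be larger than the Borel sets; in particular a Borel regular outer
  measure, restricted to its Caratheodory-measurable sets, is covered.
\<close>

definition borel_regular :: "(real ^ 'n) measure \<Rightarrow> bool" where
  "borel_regular \<mu> \<longleftrightarrow>
     space \<mu> = UNIV \<and> sets borel \<subseteq> sets \<mu> \<and>
     (\<forall>A\<in>sets \<mu>. \<exists>B\<in>sets borel. A \<subseteq> B \<and> emeasure \<mu> B = emeasure \<mu> A)"

definition cube :: "real ^ 'n \<Rightarrow> real \<Rightarrow> (real ^ 'n) set" where
  "cube x l = cbox (\<chi> i. x $ i - l / 2) (\<chi> i. x $ i + l / 2)"

definition lower_ahlfors_regular :: "(real ^ 'n) measure \<Rightarrow> real \<Rightarrow> (real ^ 'n) set \<Rightarrow> bool" where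
  "lower_ahlfors_regular \<mu> \<beta> \<Omega> \<longleftrightarrow>
     (\<exists>c>0. \<forall>x\<in>\<Omega>. \<forall>l. 0 < l \<and> l < diameter \<Omega> \<longrightarrow>
        ennreal (c * l powr \<beta>) \<le> emeasure \<mu> (cube x l))"

definition exponent :: "(real ^ 'n) measure \<Rightarrow> (real ^ 'n) set \<Rightarrow> (real ^ 'n \<Rightarrow> real) \<Rightarrow> bool" where
  "exponent \<mu> \<Omega> p \<longleftrightarrow>
     p \<in> borel_measurable (restrict_space \<mu> \<Omega>) \<and> (\<forall>x\<in>\<Omega>. 1 \<le> p x)"

text \<open>
  For \<open>x = y\<close> the inequality below reads \<open>0 \<le> 0\<close>, since \<^prop>\<open>ln (1 / 0) = (0::real)\<close>
  and \<open>C / 0 = 0\<close>; for \<open>0 < dist x y \<le> 1/2\<close> the logarithm is positive.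
\<close>

definition log_holder :: "(real ^ 'n) set \<Rightarrow> (real ^ 'n \<Rightarrow> real) \<Rightarrow> bool" where
  "log_holder \<Omega> p \<longleftrightarrow>
     (\<exists>C>0. \<forall>x\<in>\<Omega>. \<forall>y\<in>\<Omega>. dist x y \<le> 1 / 2 \<longrightarrow>
        \<bar>p x - p y\<bar> \<le> C / ln (1 / dist x y))"

text \<open>
  The infimum is only used for functions bounded below on \<open>\<Omega>\<close>, so it is taken in the reals;
  the supremum may be infinite and is taken in the extended reals.
\<close>

definition inf_on :: "(real ^ 'n) set \<Rightarrow> (real ^ 'n \<Rightarrow> real) \<Rightarrow> real" where
  "inf_on \<Omega> t = (INF x\<in>\<Omega>. t x)"

definition sup_on :: "(real ^ 'n) set \<Rightarrow> (real ^ 'n \<Rightarrow> real) \<Rightarrow> ereal" where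
  "sup_on \<Omega> t = (SUP x\<in>\<Omega>. ereal (t x))"

text \<open>Real powers on \<open>[0,\<infinity>]\<close>, with the usual conventions at \<open>0\<close> and \<open>\<infinity>\<close>.\<close>

definition epowr :: "ennreal \<Rightarrow> real \<Rightarrow> ennreal"  (infixr "epowr" 80) where
  "x epowr a =
     (if a = 0 then 1
      else if x = 0 then (if 0 < a then 0 else \<infinity>)
      else if x = \<infinity> then (if 0 < a then \<infinity> else 0)
      else ennreal (enn2real x powr a))"

definition modular ::
  "(real ^ 'n) measure \<Rightarrow> (real ^ 'n \<Rightarrow> real) \<Rightarrow> (real ^ 'n) set \<Rightarrow> (real ^ 'n \<Rightarrow> ereal) \<Rightarrow> ennreal" where
  "modular \<mu> p \<Omega> f = (\<integral>\<^sup>+x\<in>\<Omega>. (e2ennreal \<bar>f x\<bar> epowr p x) \<partial>\<mu>)"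

definition lux_norm ::
  "(real ^ 'n) measure \<Rightarrow> (real ^ 'n \<Rightarrow> real) \<Rightarrow> (real ^ 'n) set \<Rightarrow> (real ^ 'n \<Rightarrow> ereal) \<Rightarrow> ennreal" where
  "lux_norm \<mu> p \<Omega> f = Inf {ennreal l | l. 0 < l \<and> modular \<mu> p \<Omega> (\<lambda>x. f x / ereal l) \<le> 1}"

definition var_Lp ::
  "(real ^ 'n) measure \<Rightarrow> (real ^ 'n \<Rightarrow> real) \<Rightarrow> (real ^ 'n) set \<Rightarrow> (real ^ 'n \<Rightarrow> ereal) set" where
  "var_Lp \<mu> p \<Omega> =
     {f \<in> borel_measurable \<mu>. (\<forall>x. x \<notin> \<Omega> \<longrightarrow> f x = 0) \<and> lux_norm \<mu> p \<Omega> f < \<infinity>}"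

definition frac_maximal ::
  "(real ^ 'n) measure \<Rightarrow> real \<Rightarrow> real \<Rightarrow> (real ^ 'n \<Rightarrow> ereal) \<Rightarrow> real ^ 'n \<Rightarrow> ennreal" where
  "frac_maximal \<mu> \<beta> \<alpha> f x =
     (SUP r\<in>{0<..}. (\<integral>\<^sup>+y\<in>cube x r. e2ennreal \<bar>f y\<bar> \<partial>\<mu>) /
        (emeasure \<mu> (cube x r) epowr (1 - \<alpha> / \<beta>)))"

definition weight_on :: "(real ^ 'n) measure \<Rightarrow> (real ^ 'n) set \<Rightarrow> (real ^ 'n \<Rightarrow> ennreal) \<Rightarrow> bool" where
  "weight_on \<mu> \<Omega> w \<longleftrightarrow>
     w \<in> borel_measurable (restrict_space \<mu> \<Omega>) \<and>
     (AE x in \<mu>. x \<in> \<Omega> \<longrightarrow> 0 < w x \<and> w x < \<infinity>)"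

definition A_class ::
  "(real ^ 'n) measure \<Rightarrow> real \<Rightarrow> (real ^ 'n) set \<Rightarrow> (real ^ 'n \<Rightarrow> ennreal) set" where
  "A_class \<mu> \<sigma> \<Omega> = {v. weight_on \<mu> \<Omega> v \<and>
     (\<exists>C>0. \<forall>x\<in>\<Omega>. \<forall>l>0.
        ((\<integral>\<^sup>+y\<in>cube x l \<inter> \<Omega>. v y \<partial>\<mu>) / emeasure \<mu> (cube x l)) *
        ((\<integral>\<^sup>+y\<in>cube x l \<inter> \<Omega>. (v y epowr (- 1 / (\<sigma> - 1))) \<partial>\<mu>) / emeasure \<mu> (cube x l))
          epowr (\<sigma> - 1)
        \<le> ennreal C)}"

end

theory Submission
  imports Defs
begin

text \<open>
  Put \<open>\<theta> = \<alpha> / \<beta>\<close>, \<open>V = w^q\<close> and let \<open>\<nu>\<close> be the measure \<open>V \<mu>\<close> on \<open>\<Omega>\<close>.  Two identities make the weights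
  disappear: \<open>s = q (1 - \<theta>)\<close>, and \<open>(w f)^p = G^p V\<close> for \<open>f = G V^\<theta>\<close>.  The claim becomes a modular inequality
  \<open>\<integral> (M f)^q d\<nu> \<le> C\<close> for all \<open>G\<close> with \<open>\<integral> G^p d\<nu> \<le> 1\<close>, and homogeneity of the norms gives the theorem.

  The strict gap between \<open>\<sigma> = inf s - \<delta>\<close> and \<open>inf s\<close> provides an exponent \<open>a < inf p\<close> for which Hoelder's
  inequality and the condition \<open>A_\<sigma>\<close> give, on every cube \<open>Q\<close> centered in \<open>\<Omega>\<close>
  (\<open>fractional_average_Hoelder\<close>),
  \<open>\<mu>(Q)^(\<theta>-1) \<integral>\<^sub>Q f d\<mu> \<le> C \<nu>(Q)^\<theta> (mean of G^a over Q with respect to \<nu>)^(1/a)\<close>.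
  Let \<open>P \<ge> ps > a\<close> be a lower bound of \<open>p\<close> on \<open>Q \<inter> \<Omega>\<close>, let \<open>1 / q\<^sub>P = 1 / P - \<theta>\<close>, and replace \<open>G\<close> by
  \<open>H = max 1 G\<close>.  Jensen's inequality, with \<open>\<tau> = ps / a > 1\<close> and \<open>g = H^(p/\<tau>)\<close>, turns the right-hand side
  into \<open>C (mean of g)^(\<tau>/q\<^sub>P)\<close>; the factor \<open>\<nu>(Q)^\<theta>\<close> is used up by \<open>\<integral> g^\<tau> d\<nu> \<le> C\<close>
  (\<open>mean_value_power_balance\<close>).  To pass from the exponent \<open>q\<^sub>P\<close> to \<open>q\<close> at the center of \<open>Q\<close>, observe that
  the fractional mean is also at most \<open>C \<mu>(Q)^(\<theta>-1)\<close>, while log-Hoelder continuity and lower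
  regularity bound \<open>\<mu>(Q)\<close> to the power \<open>P - p\<close> for a suitable \<open>P\<close> (\<open>log_holder_local_exponent\<close>,
  \<open>exponent_at_center\<close>).  Hence \<open>(M f)^q \<le> C (M\<^sub>\<nu> g)^\<tau>\<close> pointwise, where \<open>M\<^sub>\<nu>\<close> is the centered maximal
  operator of \<open>\<nu>\<close> (\<open>fractional_average_power_le\<close>).

  It remains to bound \<open>M\<^sub>\<nu>\<close> on \<open>L^\<tau>(\<nu>)\<close>.  The measure \<open>\<nu>\<close> need not be doubling, so this rests on the
  Besicovitch covering principle.  Closed cubes allow rational sizes, and monotone
  convergence reduces the weak type \<open>(1,1)\<close> estimate to finitely many sizes, where a greedy choice works
  and cubes sharing a point have their centers in distinct orthants around that point
  (\<open>besicovitch_cubes\<close>).  Interpolation gives the strong type (\<open>centered_maximal_strong_type\<close>).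
\<close>

section \<open>Cubes\<close>

lemma mem_cube: "y \<in> cube x l \<longleftrightarrow> (\<forall>i. \<bar>x $ i - y $ i\<bar> \<le> l / 2)"
proof -
  have "(x $ i - l / 2 \<le> y $ i \<and> y $ i \<le> x $ i + l / 2) \<longleftrightarrow> \<bar>x $ i - y $ i\<bar> \<le> l / 2" for i
    by linarith
  then show ?thesis
    by (simp add: cube_def mem_box_cart)
qed

lemma mem_cube_commute: "y \<in> cube x l \<longleftrightarrow> x \<in> cube y l"
  by (simp add: mem_cube abs_minus_commute)

lemma center_in_cube: "0 \<le> l \<Longrightarrow> x \<in> cube x l"
  by (simp add: mem_cube)

lemma cube_mono: "l \<le> m \<Longrightarrow> cube x l \<subseteq> cube x m"
proof
  fix y assume "l \<le> m" "y \<in> cube x l"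
  then show "y \<in> cube x m"
    unfolding mem_cube by (meson divide_right_mono order_trans zero_le_numeral)
qed

lemma cube_borel [measurable, simp]: "cube x l \<in> sets borel"
  by (simp add: cube_def)

lemma cube_subset_cball:
  fixes x :: "real ^ 'n"
  assumes "y \<in> cube x l"
  shows "dist x y \<le> CARD('n) * (l / 2)"
proof -
  have "norm (x - y) \<le> (\<Sum>i\<in>UNIV. \<bar>(x - y) $ i\<bar>)"
    by (rule norm_le_l1_cart)
  also have "\<dots> \<le> (\<Sum>i\<in>(UNIV::'n set). l / 2)"
    using assms by (intro sum_mono) (simp add: mem_cube)
  finally show ?thesis
    by (simp add: dist_norm)
qed

lemma cball_subset_cube: "cball x (l / 2) \<subseteq> cube x l"
proof
  fix y assume "y \<in> cball x (l / 2)"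
  then have "norm (x - y) \<le> l / 2" by (simp add: dist_norm)
  then have "\<bar>(x - y) $ i\<bar> \<le> l / 2" for i
    using component_le_norm_cart[of "x - y" i] by linarith
  then show "y \<in> cube x l" by (simp add: mem_cube)
qed

lemma bounded_subset_cube:
  fixes S :: "(real ^ 'n) set"
  assumes "bounded S"
  obtains D where "0 < D" "S \<subseteq> cube x D"
proof -
  obtain e where e: "\<forall>y\<in>S. dist x y \<le> e"
    using assms unfolding bounded_any_center[of _ x] by blast
  have "S \<subseteq> cball x ((2 * \<bar>e\<bar> + 2) / 2)" using e by force
  then show ?thesis
    using cball_subset_cube[of x "2 * \<bar>e\<bar> + 2"] by (intro that[of "2 * \<bar>e\<bar> + 2"]) auto
qed

section \<open>A covering lemma of Besicovitch type\<close>

text \<open>By compactness finitely many balls of radius \<open>b / 4\<close> cover the set, and each of them contains at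
  most one point of a separated subset.\<close>

lemma separated_card_bounded:
  fixes A :: "(real ^ 'n) set"
  assumes "bounded A" "0 < b"
  obtains K where "\<And>T. finite T \<Longrightarrow> T \<subseteq> A \<Longrightarrow> \<forall>x\<in>T. \<forall>y\<in>T. x \<noteq> y \<longrightarrow> y \<notin> cube x b \<Longrightarrow> card T \<le> K"
proof -
  have "compact (closure A)"
    using assms(1) by simp
  moreover have "closure A \<subseteq> (\<Union>c\<in>closure A. ball c (b / 4))"
    using assms(2) by auto
  ultimately obtain D where D: "finite D" "closure A \<subseteq> (\<Union>c\<in>D. ball c (b / 4))"
    using compactE_image[of "closure A" "closure A" "\<lambda>c. ball c (b / 4)"] by (metis open_ball)
  have "card T \<le> card D"
    if T: "finite T" "T \<subseteq> A" "\<forall>x\<in>T. \<forall>y\<in>T. x \<noteq> y \<longrightarrow> y \<notin> cube x b" for T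
  proof -
    have "T \<subseteq> (\<Union>c\<in>D. ball c (b / 4))"
      using T(2) D(2) closure_subset by (metis order_trans)
    then have "\<forall>x\<in>T. \<exists>c\<in>D. x \<in> ball c (b / 4)"
      by blast
    then obtain f where f: "\<And>x. x \<in> T \<Longrightarrow> f x \<in> D \<and> x \<in> ball (f x) (b / 4)"
      by metis
    have "inj_on f T"
    proof (rule inj_onI, rule ccontr)
      fix x y assume *: "x \<in> T" "y \<in> T" "f x = f y" "x \<noteq> y"
      then have "dist x y \<le> b / 2"
        using f[OF *(1)] f[OF *(2)] dist_triangle3[of x y "f x"] by auto
      then have "y \<in> cube x b"
        using cball_subset_cube[of x b] by auto
      with T(3) * show False by blast
    qed
    then show ?thesis
      using f D(1) by (intro card_inj_on_le[of f]) auto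
  qed
  then show ?thesis by (rule that)
qed

lemma maximal_separated_set:
  fixes A :: "(real ^ 'n) set"
  assumes "bounded A" "0 < b"
  obtains T where "finite T" "T \<subseteq> A" "\<And>x y. x \<in> T \<Longrightarrow> y \<in> T \<Longrightarrow> x \<noteq> y \<Longrightarrow> y \<notin> cube x b"
    "A \<subseteq> (\<Union>x\<in>T. cube x b)"
proof -
  define P where "P T \<longleftrightarrow> finite T \<and> T \<subseteq> A \<and> (\<forall>x\<in>T. \<forall>y\<in>T. x \<noteq> y \<longrightarrow> y \<notin> cube x b)" for T
  obtain K where K: "\<And>T. P T \<Longrightarrow> card T \<le> K"
    using separated_card_bounded[OF assms] by (metis P_def)
  have "P {}" by (simp add: P_def)
  then obtain T where T: "P T" "\<And>T'. P T' \<Longrightarrow> card T' \<le> card T"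
    using ex_has_greatest_nat[of P "{}" card "Suc K"] K by (auto simp: less_Suc_eq_le)
  have "A \<subseteq> (\<Union>x\<in>T. cube x b)"
  proof (rule ccontr)
    assume "\<not> ?thesis"
    then obtain z where z: "z \<in> A" "\<And>x. x \<in> T \<Longrightarrow> z \<notin> cube x b" by auto
    then have "z \<notin> T" using center_in_cube[of b z] assms(2) by fastforce
    moreover have "P (insert z T)"
      unfolding P_def
    proof (intro conjI ballI impI)
      fix x y assume "x \<in> insert z T" "y \<in> insert z T" "x \<noteq> y"
      then consider "x \<in> T" "y \<in> T" | "x \<in> T" "y = z" | "y \<in> T" "x = z" by blast
      then show "y \<notin> cube x b"
        by cases (use T(1) z(2) \<open>x \<noteq> y\<close> mem_cube_commute[of x y b] in \<open>auto simp: P_def\<close>)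
    qed (use T(1) z(1) in \<open>auto simp: P_def\<close>)
    ultimately show False
      using T(1) T(2)[of "insert z T"] by (simp add: P_def)
  qed
  then show ?thesis
    using T(1) by (intro that[of T]) (auto simp: P_def)
qed

text \<open>The orthant argument: let two cubes contain \<open>z\<close>.  If their centers lie in the same closed
  orthant with vertex \<open>z\<close>, then the larger cube contains the other center.  So centers that avoid
  each other's cubes lie in distinct orthants, of which there are \<open>2^n\<close>.\<close>

lemma separated_cubes_overlap:
  fixes S :: "(real ^ 'n) set"
  assumes "finite S"
    and sep: "\<And>x y. x \<in> S \<Longrightarrow> y \<in> S \<Longrightarrow> x \<noteq> y \<Longrightarrow> y \<notin> cube x (max (l x) (l y))"
  shows "card {x \<in> S. z \<in> cube x (l x)} \<le> 2 ^ CARD('n)"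
proof -
  let ?Z = "{x \<in> S. z \<in> cube x (l x)}"
  have "inj_on (\<lambda>x. {i. z $ i \<le> x $ i}) ?Z"
  proof (rule inj_onI, rule ccontr)
    fix x y assume *: "x \<in> ?Z" "y \<in> ?Z" "{i. z $ i \<le> x $ i} = {i. z $ i \<le> y $ i}" "x \<noteq> y"
    have "\<bar>x $ i - y $ i\<bar> \<le> max (l x) (l y) / 2" for i
    proof -
      have "z $ i \<le> x $ i \<longleftrightarrow> z $ i \<le> y $ i" using *(3) by blast
      moreover have "\<bar>x $ i - z $ i\<bar> \<le> l x / 2" "\<bar>y $ i - z $ i\<bar> \<le> l y / 2"
        using * by (auto simp: mem_cube)
      ultimately show ?thesis by (cases "z $ i \<le> x $ i") (auto simp: abs_if max_def split: if_splits)
    qed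
    then show False using sep[of x y] * by (auto simp: mem_cube)
  qed
  then have "card ?Z \<le> card (UNIV :: 'n set set)"
    by (intro card_inj_on_le) auto
  then show ?thesis by (simp add: card_UNIV_set)
qed

text \<open>Exhausting the sizes from the largest to the smallest, and covering at each stage what is
  left by a maximal separated family, makes the chosen centers avoid all other chosen cubes.\<close>

lemma besicovitch_cubes:
  fixes A :: "(real ^ 'n) set"
  assumes "finite R" "\<And>r. r \<in> R \<Longrightarrow> 0 < r" "bounded A" "\<And>x. x \<in> A \<Longrightarrow> l x \<in> R"
  obtains S where "finite S" "S \<subseteq> A" "A \<subseteq> (\<Union>x\<in>S. cube x (l x))"
    "\<And>z. card {x \<in> S. z \<in> cube x (l x)} \<le> 2 ^ CARD('n)"
proof -
  have "\<exists>S. finite S \<and> S \<subseteq> A \<and> A \<subseteq> (\<Union>x\<in>S. cube x (l x)) \<and>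
      (\<forall>x\<in>S. \<forall>y\<in>S. x \<noteq> y \<longrightarrow> y \<notin> cube x (max (l x) (l y)))"
    using assms
    \<comment> \<open>The induction adds the smallest size last, so that it is treated after all larger ones.\<close>
  proof (induction R arbitrary: A rule: finite_linorder_min_induct)
    case empty
    then show ?case by (intro exI[of _ "{}"]) auto
  next
    case (insert b R)
    define A1 where "A1 = {x \<in> A. l x \<in> R}"
    have "bounded A1" using insert.prems(2) by (rule bounded_subset) (auto simp: A1_def)
    then have "\<exists>S. finite S \<and> S \<subseteq> A1 \<and> A1 \<subseteq> (\<Union>x\<in>S. cube x (l x)) \<and>
        (\<forall>x\<in>S. \<forall>y\<in>S. x \<noteq> y \<longrightarrow> y \<notin> cube x (max (l x) (l y)))"
      by (intro insert.IH) (use insert.prems(1) in \<open>simp_all add: A1_def\<close>)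
    then obtain S where S: "finite S" "S \<subseteq> A1" "A1 \<subseteq> (\<Union>x\<in>S. cube x (l x))"
      "\<And>x y. x \<in> S \<Longrightarrow> y \<in> S \<Longrightarrow> x \<noteq> y \<Longrightarrow> y \<notin> cube x (max (l x) (l y))"
      by (elim exE conjE) blast
    define A2 where "A2 = {x \<in> A. l x = b \<and> x \<notin> (\<Union>x\<in>S. cube x (l x))}"
    have "bounded A2" using insert.prems(2) by (rule bounded_subset) (auto simp: A2_def)
    then obtain T where T: "finite T" "T \<subseteq> A2" "\<And>x y. x \<in> T \<Longrightarrow> y \<in> T \<Longrightarrow> x \<noteq> y \<Longrightarrow> y \<notin> cube x b"
      "A2 \<subseteq> (\<Union>x\<in>T. cube x b)"
      by (rule maximal_separated_set[of A2 b]) (use insert.prems(1) in simp, blast)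
    have lT: "\<And>x. x \<in> T \<Longrightarrow> l x = b" using T(2) by (auto simp: A2_def)
    have lS: "\<And>x. x \<in> S \<Longrightarrow> b < l x" using S(2) insert.hyps by (auto simp: A1_def)
    have cross: "y \<notin> cube x (max (l x) (l y)) \<and> x \<notin> cube y (max (l y) (l x))"
      if "x \<in> S" "y \<in> T" for x y
    proof -
      have "y \<notin> cube x (l x)" using that T(2) by (auto simp: A2_def)
      moreover have "max (l x) (l y) = l x" using lS[OF that(1)] lT[OF that(2)] by simp
      ultimately show ?thesis using mem_cube_commute by (metis max.commute)
    qed
    have "A \<subseteq> (\<Union>x\<in>S \<union> T. cube x (l x))"
    proof
      fix x assume x: "x \<in> A"
      then have "x \<in> A1 \<or> x \<in> A2 \<or> x \<in> (\<Union>x\<in>S. cube x (l x))"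
        using insert.prems(3) by (auto simp: A1_def A2_def)
      then show "x \<in> (\<Union>x\<in>S \<union> T. cube x (l x))"
        using S(3) T(4) lT by fastforce
    qed
    moreover have "\<forall>x\<in>S \<union> T. \<forall>y\<in>S \<union> T. x \<noteq> y \<longrightarrow> y \<notin> cube x (max (l x) (l y))"
      using S(4) T(3) cross lT by fastforce
    ultimately show ?case
      using S T by (intro exI[of _ "S \<union> T"]) (auto simp: A1_def A2_def)
  qed
  then obtain S where "finite S" "S \<subseteq> A" "A \<subseteq> (\<Union>x\<in>S. cube x (l x))"
      "\<And>x y. x \<in> S \<Longrightarrow> y \<in> S \<Longrightarrow> x \<noteq> y \<Longrightarrow> y \<notin> cube x (max (l x) (l y))"
    by (elim exE conjE) blast
  then show ?thesis
    by (intro that[of S]) (auto intro!: separated_cubes_overlap)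
qed

section \<open>Powers in the extended half-line\<close>

lemma epowr_ennreal: "0 \<le> x \<Longrightarrow> 0 < a \<Longrightarrow> ennreal x epowr a = ennreal (x powr a)"
  by (auto simp: epowr_def ennreal_eq_0_iff top_neq_ennreal)

lemma epowr_pos_ennreal: "0 < x \<Longrightarrow> ennreal x epowr a = ennreal (x powr a)"
  by (auto simp: epowr_def ennreal_eq_0_iff)

lemma epowr_top: "0 < a \<Longrightarrow> top epowr a = top"
  by (simp add: epowr_def)

lemma epowr_zero: "0 < a \<Longrightarrow> 0 epowr a = 0"
  by (simp add: epowr_def)

lemma epowr_mono:
  assumes "x \<le> y" "0 < a"
  shows "x epowr a \<le> y epowr a"
  using assms
  by (cases x; cases y) (auto simp: epowr_ennreal epowr_top ennreal_le_iff top_unique intro!: powr_mono2)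

lemma epowr_mult:
  assumes "0 < a"
  shows "(x * y) epowr a = x epowr a * y epowr a"
proof (cases "x = top \<or> y = top")
  case True
  have "(top * z) epowr a = top epowr a * z epowr a" for z :: ennreal
    using assms by (cases z) (auto simp: epowr_ennreal epowr_top epowr_zero ennreal_top_mult ennreal_eq_0_iff)
  with True show ?thesis by (metis mult.commute)
next
  case False
  then obtain r s where "x = ennreal r" "y = ennreal s" "0 \<le> r" "0 \<le> s"
    by (cases x; cases y) auto
  with assms show ?thesis
    by (simp add: epowr_ennreal powr_mult flip: ennreal_mult)
qed

lemma epowr_epowr:
  assumes "0 < a" "0 < b"
  shows "(x epowr a) epowr b = x epowr (a * b)"
  using assms by (cases x) (auto simp: epowr_ennreal epowr_top powr_powr)

lemma epowr_one: "x epowr 1 = x"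
  by (cases x) (auto simp: epowr_ennreal epowr_top)

lemma epowr_le_iff:
  assumes "0 < a"
  shows "x epowr a \<le> y \<longleftrightarrow> x \<le> y epowr (1 / a)"
proof
  assume "x epowr a \<le> y"
  then have "(x epowr a) epowr (1 / a) \<le> y epowr (1 / a)"
    using assms by (intro epowr_mono) auto
  then show "x \<le> y epowr (1 / a)"
    using assms by (simp add: epowr_epowr epowr_one)
next
  assume "x \<le> y epowr (1 / a)"
  then have "x epowr a \<le> (y epowr (1 / a)) epowr a"
    using assms by (intro epowr_mono) auto
  then show "x epowr a \<le> y"
    using assms by (simp add: epowr_epowr epowr_one)
qed

lemma borel_measurable_epowr [measurable (raw)]:
  assumes "f \<in> borel_measurable M"
  shows "(\<lambda>x. f x epowr a) \<in> borel_measurable M"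
proof -
  have [measurable]: "(\<lambda>x. ennreal (enn2real x powr a)) \<in> borel_measurable borel"
    by measurable
  have "(\<lambda>x. x epowr a) \<in> borel_measurable borel"
    unfolding epowr_def by (intro measurable_If) auto
  then show ?thesis
    by (rule measurable_compose[OF assms])
qed

section \<open>The centered maximal function of an arbitrary finite measure\<close>

definition centered_maximal ::
  "(real ^ 'n) measure \<Rightarrow> (real ^ 'n \<Rightarrow> ennreal) \<Rightarrow> real ^ 'n \<Rightarrow> ennreal" where
  "centered_maximal \<nu> g x =
     (SUP r\<in>{0<..}. (\<integral>\<^sup>+y\<in>cube x r. g y \<partial>\<nu>) / emeasure \<nu> (cube x r))"

text \<open>Sum the hypothesis over a subfamily of cubes that covers \<open>E\<close> and has overlap at most \<open>2^n\<close>.\<close>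

lemma weak_type_finitely_many_sizes:
  fixes \<nu> :: "(real ^ 'n) measure"
  assumes [simp]: "sets borel \<subseteq> sets \<nu>" and g [measurable]: "g \<in> borel_measurable \<nu>"
    and R: "finite R" "\<And>r. r \<in> R \<Longrightarrow> 0 < r" and "bounded E"
    and E: "\<And>x. x \<in> E \<Longrightarrow> \<exists>r\<in>R. t * emeasure \<nu> (cube x r) \<le> (\<integral>\<^sup>+y\<in>cube x r. g y \<partial>\<nu>)"
  shows "t * emeasure \<nu> E \<le> 2 ^ CARD('n) * (\<integral>\<^sup>+y. g y \<partial>\<nu>)"
proof -
  have [measurable]: "cube x r \<in> sets \<nu>" for x r
    using cube_borel assms(1) by blast
  obtain l where l: "\<And>x. x \<in> E \<Longrightarrow> l x \<in> R"
      "\<And>x. x \<in> E \<Longrightarrow> t * emeasure \<nu> (cube x (l x)) \<le> (\<integral>\<^sup>+y\<in>cube x (l x). g y \<partial>\<nu>)"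
    using E by metis
  obtain S where S: "finite S" "S \<subseteq> E" "E \<subseteq> (\<Union>x\<in>S. cube x (l x))"
      "\<And>z. card {x \<in> S. z \<in> cube x (l x)} \<le> 2 ^ CARD('n)"
    by (rule besicovitch_cubes[OF R \<open>bounded E\<close> l(1)]) blast+
  have "t * emeasure \<nu> E \<le> t * emeasure \<nu> (\<Union>x\<in>S. cube x (l x))"
    using S by (intro mult_left_mono emeasure_mono) auto
  also have "\<dots> \<le> t * (\<Sum>x\<in>S. emeasure \<nu> (cube x (l x)))"
    using S by (intro mult_left_mono emeasure_subadditive_finite) auto
  also have "\<dots> \<le> (\<Sum>x\<in>S. \<integral>\<^sup>+y\<in>cube x (l x). g y \<partial>\<nu>)"
    unfolding sum_distrib_left using S(2) l(2) by (intro sum_mono) auto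
  also have "\<dots> = (\<integral>\<^sup>+y. (\<Sum>x\<in>S. g y * indicator (cube x (l x)) y) \<partial>\<nu>)"
    by (intro nn_integral_sum[symmetric]) measurable
  also have "\<dots> \<le> (\<integral>\<^sup>+y. 2 ^ CARD('n) * g y \<partial>\<nu>)"
  proof (rule nn_integral_mono)
    fix y
    have "(\<Sum>x\<in>S. indicator (cube x (l x)) y :: ennreal) = (\<Sum>x\<in>S. if y \<in> cube x (l x) then 1 else 0)"
      by (intro sum.cong) (auto simp: indicator_def)
    also have "\<dots> = of_nat (card {x \<in> S. y \<in> cube x (l x)})"
      using S(1) by (simp add: sum.If_cases Int_def)
    also have "\<dots> \<le> of_nat (2 ^ CARD('n))"
      using S(4) by (intro of_nat_mono)
    finally have *: "(\<Sum>x\<in>S. indicator (cube x (l x)) y :: ennreal) \<le> 2 ^ CARD('n)"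
      by simp
    have "(\<Sum>x\<in>S. g y * indicator (cube x (l x)) y) = g y * (\<Sum>x\<in>S. indicator (cube x (l x)) y)"
      by (simp add: sum_distrib_left)
    also have "\<dots> \<le> 2 ^ CARD('n) * g y"
      using mult_left_mono[OF *, of "g y"] by (simp add: mult.commute)
    finally show "(\<Sum>x\<in>S. g y * indicator (cube x (l x)) y) \<le> 2 ^ CARD('n) * g y" .
  qed
  also have "\<dots> = 2 ^ CARD('n) * (\<integral>\<^sup>+y. g y \<partial>\<nu>)"
    by (intro nn_integral_cmult) measurable
  finally show ?thesis .
qed

lemma less_divide_ennreal_iff:
  fixes a b t :: ennreal
  assumes "b < top" "b = 0 \<Longrightarrow> a = 0"
  shows "t < a / b \<longleftrightarrow> t * b < a"
proof (cases "b = 0")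
  case True
  then show ?thesis using assms(2) by simp
next
  case False
  then have "a / b \<le> t \<longleftrightarrow> a \<le> t * b"
    using assms(1)
    by (metis divide_le_posI_ennreal ennreal_divide_times ennreal_divide_self less_top mult.commute
        mult.right_neutral mult_right_mono not_gr_zero zero_le)
  then show ?thesis by (simp flip: not_le)
qed

locale finite_borel_measure = finite_measure M for M :: "(real ^ 'n) measure" +
  assumes borel_subset: "sets borel \<subseteq> sets M" and space_UNIV: "space M = UNIV"
begin

lemma cube_sets [measurable, simp]: "cube x r \<in> sets M"
  using cube_borel borel_subset by blast

lemma borel_measurable_of_borel: "f \<in> borel_measurable borel \<Longrightarrow> f \<in> borel_measurable M"
  using measurable_mono[of borel borel borel M] borel_subset space_UNIV by auto

lemma measurable_integral_over_cube:
  assumes g: "g \<in> borel_measurable M"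
  shows "(\<lambda>x. \<integral>\<^sup>+y\<in>cube x r. g y \<partial>M) \<in> borel_measurable borel"
proof -
  have id: "(\<lambda>y. y) \<in> measurable M borel"
    by (rule borel_measurable_of_borel) simp
  have "closed {z :: (real ^ 'n) \<times> (real ^ 'n). \<forall>i. \<bar>fst z $ i - snd z $ i\<bar> \<le> r / 2}"
    by (intro closed_Collect_all closed_Collect_le continuous_intros)
  then have "{z :: (real ^ 'n) \<times> (real ^ 'n). \<forall>i. \<bar>fst z $ i - snd z $ i\<bar> \<le> r / 2} \<in> sets (borel \<Otimes>\<^sub>M borel)"
    by (subst borel_prod) (rule borel_closed)
  then have P: "Measurable.pred (borel \<Otimes>\<^sub>M borel) (\<lambda>z :: (real ^ 'n) \<times> (real ^ 'n). snd z \<in> cube (fst z) r)"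
    by (simp add: pred_def mem_cube space_pair_measure)
  have "(\<lambda>z. (fst z, snd z)) \<in> measurable (borel \<Otimes>\<^sub>M M) (borel \<Otimes>\<^sub>M (borel :: (real ^ 'n) measure))"
    using id by (intro measurable_Pair measurable_compose[OF measurable_snd]) auto
  from measurable_compose[OF this P] have [measurable]: "Measurable.pred (borel \<Otimes>\<^sub>M M) (\<lambda>z :: (real ^ 'n) \<times> (real ^ 'n). snd z \<in> cube (fst z) r)"
    by simp
  have "(\<lambda>z. g (snd z) * (if snd z \<in> cube (fst z) r then 1 else 0)) \<in> borel_measurable (borel \<Otimes>\<^sub>M M)"
    using g by measurable
  then have "(\<lambda>x. \<integral>\<^sup>+y. g y * (if y \<in> cube x r then 1 else 0) \<partial>M) \<in> borel_measurable borel"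
    by (intro borel_measurable_nn_integral) (simp add: case_prod_unfold)
  then show ?thesis
    by (simp add: indicator_def of_bool_def)
qed

text \<open>Shrinking cubes to a closed cube makes the measures converge, so that rational sizes
  suffice.\<close>

lemma less_centered_maximal_iff:
  "t < centered_maximal M g x \<longleftrightarrow>
    (\<exists>r\<in>\<rat> \<inter> {0<..}. t * emeasure M (cube x r) < (\<integral>\<^sup>+y\<in>cube x r. g y \<partial>M))"
proof -
  have iff: "t < (\<integral>\<^sup>+y\<in>cube x r. g y \<partial>M) / emeasure M (cube x r) \<longleftrightarrow>
      t * emeasure M (cube x r) < (\<integral>\<^sup>+y\<in>cube x r. g y \<partial>M)" for r
  proof (rule less_divide_ennreal_iff)
    assume "emeasure M (cube x r) = 0"
    then show "(\<integral>\<^sup>+y\<in>cube x r. g y \<partial>M) = 0"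
      by (intro nn_integral_null_set) auto
  qed (simp add: less_top[symmetric])
  have "\<exists>r'\<in>\<rat> \<inter> {0<..}. t * emeasure M (cube x r') < (\<integral>\<^sup>+y\<in>cube x r'. g y \<partial>M)"
    if r: "0 < r" "t * emeasure M (cube x r) < (\<integral>\<^sup>+y\<in>cube x r. g y \<partial>M)" for r
  proof -
    have "t < top"
      using r(2) iff[of r] by (metis order.strict_trans1 top.not_eq_extremum top_greatest not_less)
    define Q where "Q k = cube x (r + 1 / real (Suc k))" for k
    have "decseq Q"
      unfolding Q_def by (intro antimonoI cube_mono) (simp add: frac_le)
    have "(\<Inter>k. Q k) = cube x r"
    proof
      show "(\<Inter>k. Q k) \<subseteq> cube x r"
      proof
        fix y assume "y \<in> (\<Inter>k. Q k)"
        then have "\<bar>x $ i - y $ i\<bar> \<le> (r + 1 / real (Suc k)) / 2" for k i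
          by (auto simp: Q_def mem_cube)
        moreover have "(\<lambda>k. (r + 1 / real (Suc k)) / 2) \<longlonglongrightarrow> (r + 0) / 2"
          by (intro tendsto_intros LIMSEQ_Suc[OF lim_1_over_n]) auto
        ultimately have "\<bar>x $ i - y $ i\<bar> \<le> (r + 0) / 2" for i
          by (intro LIMSEQ_le_const) auto
        then show "y \<in> cube x r" by (simp add: mem_cube)
      qed
      show "cube x r \<subseteq> (\<Inter>k. Q k)"
        unfolding Q_def by (intro INT_greatest cube_mono) simp
    qed
    moreover have "(\<lambda>k. emeasure M (Q k)) \<longlonglongrightarrow> emeasure M (\<Inter>k. Q k)"
    proof (rule Lim_emeasure_decseq)
      show "range Q \<subseteq> sets M" by (auto simp: Q_def)
    qed (use \<open>decseq Q\<close> in simp_all)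
    ultimately have "(\<lambda>k. t * emeasure M (Q k)) \<longlonglongrightarrow> t * emeasure M (cube x r)"
      using \<open>t < top\<close> by (intro ennreal_tendsto_cmult) auto
    then have "\<forall>\<^sub>F k in sequentially. t * emeasure M (Q k) < (\<integral>\<^sup>+y\<in>cube x r. g y \<partial>M)"
      using r(2) by (rule order_tendstoD)
    then obtain k where k: "t * emeasure M (Q k) < (\<integral>\<^sup>+y\<in>cube x r. g y \<partial>M)"
      by (auto simp: eventually_sequentially)
    obtain r' where r': "r' \<in> \<rat>" "r < r'" "r' < r + 1 / real (Suc k)"
      using Rats_dense_in_real[of r "r + 1 / real (Suc k)"] by auto
    have "t * emeasure M (cube x r') \<le> t * emeasure M (Q k)"
      unfolding Q_def using r' by (intro mult_left_mono emeasure_mono cube_mono) auto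
    also note k
    also have "(\<integral>\<^sup>+y\<in>cube x r. g y \<partial>M) \<le> (\<integral>\<^sup>+y\<in>cube x r'. g y \<partial>M)"
      using cube_mono[of r r' x] r' by (intro nn_integral_mono mult_left_mono) (auto simp: indicator_def)
    finally show ?thesis using r' r(1) by auto
  qed
  then show ?thesis
    by (auto simp: centered_maximal_def less_SUP_iff iff)
qed

lemma borel_measurable_centered_maximal:
  assumes "g \<in> borel_measurable M"
  shows "centered_maximal M g \<in> borel_measurable borel"
proof (rule borel_measurableI_greater)
  fix t :: ennreal
  have [measurable]: "(\<lambda>x. \<integral>\<^sup>+y\<in>cube x r. g y \<partial>M) \<in> borel_measurable borel" for r
    using assms by (rule measurable_integral_over_cube)
  have "(\<lambda>x. emeasure M (cube x r)) = (\<lambda>x. \<integral>\<^sup>+y\<in>cube x r. 1 \<partial>M)" for r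
    by (auto intro!: ext)
  then have [measurable]: "(\<lambda>x. emeasure M (cube x r)) \<in> borel_measurable borel" for r
    using measurable_integral_over_cube[of "\<lambda>_. 1"] by simp
  have *: "{x \<in> space borel. t < centered_maximal M g x} =
      (\<Union>r\<in>\<rat> \<inter> {0<..}. {x \<in> space borel. t * emeasure M (cube x r) < (\<integral>\<^sup>+y\<in>cube x r. g y \<partial>M)})"
    by (auto simp: less_centered_maximal_iff)
  show "{x \<in> space borel. t < centered_maximal M g x} \<in> sets borel"
    unfolding * by (intro sets.countable_UN'') (auto simp: countable_rat)
qed

text \<open>The superlevel set is the increasing union of the sets obtained from the first \<open>k\<close> rational sizes.
  The bound for finitely many sizes depends only on the dimension, so it passes to the limit.\<close>

lemma centered_maximal_weak_type:
  assumes g [measurable]: "g \<in> borel_measurable M"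
    and "bounded B" "B \<in> sets M"
  shows "t * emeasure M {x \<in> B. t < centered_maximal M g x} \<le> 2 ^ CARD('n) * (\<integral>\<^sup>+y. g y \<partial>M)"
proof -
  define q where "q = from_nat_into (\<rat> \<inter> {0<..} :: real set)"
  have "countable (\<rat> \<inter> {0<..} :: real set)" "(1::real) \<in> \<rat> \<inter> {0<..}"
    by (auto intro: countable_Int1 countable_rat)
  then have q: "range q = \<rat> \<inter> {0<..}"
    unfolding q_def by (intro range_from_nat_into) auto
  define E where "E k = {x \<in> B. \<exists>r\<in>q ` {..k}. t * emeasure M (cube x r) < (\<integral>\<^sup>+y\<in>cube x r. g y \<partial>M)}" for k
  have [measurable]: "(\<lambda>x. \<integral>\<^sup>+y\<in>cube x r. g y \<partial>M) \<in> borel_measurable M"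
    "(\<lambda>x. emeasure M (cube x r)) \<in> borel_measurable M" for r
  proof -
    have "(\<lambda>x. emeasure M (cube x r)) = (\<lambda>x. \<integral>\<^sup>+y\<in>cube x r. 1 \<partial>M)"
      by (auto intro!: ext)
    then show "(\<lambda>x. \<integral>\<^sup>+y\<in>cube x r. g y \<partial>M) \<in> borel_measurable M"
        "(\<lambda>x. emeasure M (cube x r)) \<in> borel_measurable M"
      using measurable_integral_over_cube[OF g, of r]
        measurable_integral_over_cube[of "\<lambda>_. 1" r] by (auto intro: borel_measurable_of_borel)
  qed
  have E_sets: "E k \<in> sets M" for k
  proof -
    have "E k = B \<inter> (\<Union>r\<in>q ` {..k}. {x \<in> space M. t * emeasure M (cube x r) < (\<integral>\<^sup>+y\<in>cube x r. g y \<partial>M)})"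
      using space_UNIV by (auto simp: E_def)
    also have "\<dots> \<in> sets M"
      using \<open>B \<in> sets M\<close> by (intro sets.Int sets.finite_UN) auto
    finally show ?thesis .
  qed
  have "{x \<in> B. t < centered_maximal M g x} = (\<Union>k. E k)"
    by (auto simp: less_centered_maximal_iff E_def simp flip: q)
  also have "emeasure M \<dots> = (SUP k. emeasure M (E k))"
  proof (rule SUP_emeasure_incseq[symmetric])
    show "incseq E" by (rule monoI) (fastforce simp: E_def)
  qed (use E_sets in auto)
  also have "t * \<dots> = (SUP k. t * emeasure M (E k))"
    by (simp add: SUP_mult_left_ennreal)
  also have "\<dots> \<le> 2 ^ CARD('n) * (\<integral>\<^sup>+y. g y \<partial>M)"
  proof (rule SUP_least)
    fix k
    have "0 < r" if "r \<in> q ` {..k}" for r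
      using that q by auto
    moreover have "bounded (E k)"
      using \<open>bounded B\<close> by (rule bounded_subset) (auto simp: E_def)
    ultimately show "t * emeasure M (E k) \<le> 2 ^ CARD('n) * (\<integral>\<^sup>+y. g y \<partial>M)"
      by (intro weak_type_finitely_many_sizes[where R = "q ` {..k}"] borel_subset g)
         (auto simp: E_def intro: less_imp_le)
  qed
  finally show ?thesis .
qed

end

text \<open>The next two lemmas discretise the layer cake formula along powers of \<open>2\<close>.\<close>

lemma truncated_geometric_sum_le:
  fixes x \<gamma> :: real
  assumes "0 < \<gamma>" "0 \<le> x"
  shows "(\<Sum>k<n. (2 powr \<gamma>) ^ k * (if 2 ^ k < x then 1 else 0))
    \<le> 2 powr \<gamma> / (2 powr \<gamma> - 1) * x powr \<gamma>"
proof (induction n)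
  case 0
  have "1 \<le> 2 powr \<gamma>" using assms by (simp add: ge_one_powr_ge_zero)
  then show ?case by simp
next
  case (Suc n)
  define c where "c = 2 powr \<gamma>"
  have c: "1 < c" using assms by (simp add: c_def)
  show ?case
  proof (cases "2 ^ n < x")
    case True
    have "(\<Sum>k<Suc n. c ^ k * (if 2 ^ k < x then 1 else 0)) \<le> (\<Sum>k<Suc n. c ^ k)"
      using c by (intro sum_mono) auto
    also have "\<dots> = (c ^ Suc n - 1) / (c - 1)"
      using c by (intro geometric_sum) auto
    also have "\<dots> \<le> c ^ Suc n / (c - 1)"
      using c by (intro divide_right_mono) auto
    also have "\<dots> = c / (c - 1) * c ^ n" by simp
    also have "c ^ n = (2 ^ n) powr \<gamma>"
      by (simp add: c_def powr_power powr_powr mult.commute flip: powr_realpow)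
    also have "c / (c - 1) * \<dots> \<le> c / (c - 1) * x powr \<gamma>"
      using True assms c by (intro mult_left_mono powr_mono2) auto
    finally show ?thesis
      unfolding c_def .
  next
    case False
    with Suc show ?thesis by simp
  qed
qed

lemma epowr_le_dyadic_sum:
  assumes "0 < \<tau>"
  shows "x epowr \<tau> \<le> ennreal (4 powr \<tau>) *
    (1 + (\<Sum>k. ennreal ((2 powr \<tau>) ^ k) * (if 2 * 2 ^ k < x then 1 else 0)))"
    (is "_ \<le> _ * (1 + suminf ?f)")
proof (cases x)
  case top
  have "1 \<le> (2 powr \<tau>) ^ k" for k
    using assms by (intro one_le_power) (simp add: ge_one_powr_ge_zero)
  moreover have "2 * 2 ^ k < (top :: ennreal)" for k
    by (simp add: ennreal_mult_less_top power_less_top_ennreal)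
  ultimately have "of_nat n \<le> (\<Sum>k<n. ?f k)" for n
    using sum_mono[of "{..<n}" "\<lambda>_. 1" ?f] top by simp
  then have "of_nat n \<le> suminf ?f" for n
    by (rule order_trans[OF _ sum_le_suminf]) (auto intro: summableI)
  then have "(SUP n. of_nat n) \<le> suminf ?f" by (rule SUP_least)
  then have "suminf ?f = top" by (simp only: ennreal_SUP_of_nat_eq_top top_unique)
  then show ?thesis
    using assms by (simp add: ennreal_mult_top)
next
  case (real y)
  show ?thesis
  proof (cases "y \<le> 4")
    case True
    then have "x epowr \<tau> \<le> ennreal (4 powr \<tau>) * 1"
      using real assms by (auto simp: epowr_ennreal intro!: ennreal_leI powr_mono2)
    also have "\<dots> \<le> ennreal (4 powr \<tau>) * (1 + suminf ?f)"
      by (intro mult_left_mono) auto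
    finally show ?thesis .
  next
    case False
    obtain m :: nat where "y < 2 ^ m" using real_arch_pow[of 2 y] by force
    moreover have "(2::real) ^ m \<le> 2 ^ (m + 2)" by (rule power_increasing) auto
    ultimately have "y \<le> 2 ^ (m + 2)" by linarith
    define k where "k = (LEAST m. y \<le> 2 ^ (m + 2))"
    have k: "y \<le> 2 ^ (k + 2)"
      unfolding k_def using \<open>y \<le> 2 ^ (m + 2)\<close> by (rule LeastI)
    have "0 < k" using k False by (cases k) auto
    then have "\<not> y \<le> 2 ^ (k - 1 + 2)"
      unfolding k_def by (intro not_less_Least) auto
    moreover have "(2::real) ^ (k - 1 + 2) = 2 * 2 ^ k"
      using \<open>0 < k\<close> by (cases k) auto
    ultimately have "2 * 2 ^ k < y" by simp
    then have "ennreal (2 * 2 ^ k) < x"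
      using real by (simp add: ennreal_less_iff)
    then have "2 * 2 ^ k < x"
      by (simp add: ennreal_mult ennreal_power flip: ennreal_numeral)
    then have f: "?f k = ennreal ((2 powr \<tau>) ^ k)" by simp
    have "y powr \<tau> \<le> (2 ^ (k + 2)) powr \<tau>"
      using k real assms by (intro powr_mono2) auto
    also have "\<dots> = (4 * 2 ^ k) powr \<tau>" by simp
    also have "\<dots> = 4 powr \<tau> * (2 ^ k) powr \<tau>"
      by (rule powr_mult)
    also have "(2 ^ k) powr \<tau> = (2 powr \<tau>) ^ k"
      by (simp add: powr_power powr_powr mult.commute flip: powr_realpow)
    finally have "x epowr \<tau> \<le> ennreal (4 powr \<tau>) * ?f k"
      unfolding f using real assms by (simp add: epowr_ennreal ennreal_leI flip: ennreal_mult)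
    also have "?f k \<le> suminf ?f"
      using sum_le_suminf[of ?f "{k}"] by (simp add: summableI)
    also have "suminf ?f \<le> 1 + suminf ?f" by simp
    finally show ?thesis by (simp add: mult_left_mono)
  qed
qed

context finite_borel_measure
begin

text \<open>The part of \<open>g\<close> below the level \<open>t\<close> contributes at most \<open>t\<close> to every mean, so only the part above
  \<open>t\<close> can lift a mean over \<open>2 t\<close>.\<close>

lemma centered_maximal_weak_type_truncated:
  fixes t :: real
  assumes g [measurable]: "g \<in> borel_measurable M" and "bounded B" "B \<in> sets M" "0 < t"
  shows "emeasure M {x \<in> B. 2 * ennreal t < centered_maximal M (\<lambda>y. ennreal (g y)) x} \<le>
    ennreal (2 ^ CARD('n) / t) * (\<integral>\<^sup>+y. ennreal (g y) * (if t < g y then 1 else 0) \<partial>M)"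
    (is "emeasure M ?E \<le> _ * ?I")
proof -
  define h where "h y = ennreal (g y) * (if t < g y then 1 else 0)" for y
  have [measurable]: "h \<in> borel_measurable M" unfolding h_def by measurable
  have "ennreal t < centered_maximal M h x"
    if "2 * ennreal t < centered_maximal M (\<lambda>y. ennreal (g y)) x" for x
  proof -
    from that obtain r where r: "r \<in> \<rat> \<inter> {0<..}"
      "2 * ennreal t * emeasure M (cube x r) < (\<integral>\<^sup>+y\<in>cube x r. ennreal (g y) \<partial>M)"
      unfolding less_centered_maximal_iff by blast
    note r(2)
    also have "(\<integral>\<^sup>+y\<in>cube x r. ennreal (g y) \<partial>M) \<le>
        (\<integral>\<^sup>+y. ennreal t * indicator (cube x r) y + h y * indicator (cube x r) y \<partial>M)"
    proof (rule nn_integral_mono)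
      fix y
      show "ennreal (g y) * indicator (cube x r) y
          \<le> ennreal t * indicator (cube x r) y + h y * indicator (cube x r) y"
        by (cases "t < g y") (auto simp: h_def indicator_def intro!: ennreal_leI)
    qed
    also have "\<dots> = ennreal t * emeasure M (cube x r) + (\<integral>\<^sup>+y\<in>cube x r. h y \<partial>M)"
      by (subst nn_integral_add) (auto simp: nn_integral_cmult_indicator)
    also have "2 * ennreal t * emeasure M (cube x r) =
        ennreal t * emeasure M (cube x r) + ennreal t * emeasure M (cube x r)"
      by (simp add: mult_2 distrib_right)
    finally have "ennreal t * emeasure M (cube x r) < (\<integral>\<^sup>+y\<in>cube x r. h y \<partial>M)"
      by (simp add: ennreal_add_left_cancel_less)
    then show ?thesis
      unfolding less_centered_maximal_iff using r(1) by blast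
  qed
  then have "ennreal t * emeasure M ?E \<le> ennreal t * emeasure M {x \<in> B. ennreal t < centered_maximal M h x}"
  proof (intro mult_left_mono emeasure_mono)
    have "{x \<in> B. ennreal t < centered_maximal M h x} =
        B \<inter> {x \<in> space M. ennreal t < centered_maximal M h x}"
      using space_UNIV by auto
    also have "\<dots> \<in> sets M"
      using borel_measurable_of_borel[OF borel_measurable_centered_maximal[of h]] \<open>B \<in> sets M\<close>
      by (intro sets.Int borel_measurable_less) auto
    finally show "{x \<in> B. ennreal t < centered_maximal M h x} \<in> sets M" .
  qed auto
  also have "\<dots> \<le> 2 ^ CARD('n) * ?I"
    using centered_maximal_weak_type[of h B "ennreal t"] assms by (simp add: h_def)
  finally have "ennreal (1 / t) * (ennreal t * emeasure M ?E) \<le> ennreal (1 / t) * (2 ^ CARD('n) * ?I)"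
    by (intro mult_left_mono) auto
  moreover have "ennreal (1 / t) * (ennreal t * emeasure M ?E) = emeasure M ?E"
    using \<open>0 < t\<close> by (simp add: mult.assoc[symmetric] flip: ennreal_mult)
  moreover have "ennreal (1 / t) * (2 ^ CARD('n) * ?I) = ennreal (2 ^ CARD('n) / t) * ?I"
  proof -
    have "ennreal (1 / t) * 2 ^ CARD('n) = ennreal (1 / t) * ennreal (2 ^ CARD('n))"
      by (simp add: ennreal_power flip: ennreal_numeral)
    also have "\<dots> = ennreal (2 ^ CARD('n) / t)"
      using \<open>0 < t\<close> by (simp flip: ennreal_mult)
    finally show ?thesis by (simp add: mult.assoc[symmetric])
  qed
  ultimately show ?thesis by simp
qed

text \<open>Marcinkiewicz interpolation over dyadic levels.  Levels below \<open>1\<close> are not interpolated but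
  estimated by the finite measure of \<open>B\<close>.\<close>

lemma centered_maximal_strong_type:
  assumes g [measurable]: "g \<in> borel_measurable M" "\<And>y. 0 \<le> g y" and "bounded B" "B \<in> sets M" and \<tau>: "1 < \<tau>"
  shows "(\<integral>\<^sup>+x\<in>B. centered_maximal M (\<lambda>y. ennreal (g y)) x epowr \<tau> \<partial>M) \<le>
    ennreal (4 powr \<tau>) * (emeasure M B +
      ennreal (2 ^ CARD('n) * (2 powr (\<tau> - 1) / (2 powr (\<tau> - 1) - 1))) * (\<integral>\<^sup>+y. ennreal (g y powr \<tau>) \<partial>M))"
proof -
  let ?Mg = "centered_maximal M (\<lambda>y. ennreal (g y))"
  define c where "c = 2 powr (\<tau> - 1)"
  have c: "1 < c" using \<tau> by (simp add: c_def)
  have Mg [measurable]: "?Mg \<in> borel_measurable M"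
    by (rule borel_measurable_of_borel, rule borel_measurable_centered_maximal) measurable
  note \<open>B \<in> sets M\<close>[measurable]
  define E where "E k = {x \<in> B. 2 * ennreal (2 ^ k) < ?Mg x}" for k :: nat
  have "E k = B \<inter> {x \<in> space M. 2 * ennreal (2 ^ k) < ?Mg x}" for k
    using space_UNIV by (auto simp: E_def)
  then have [measurable]: "E k \<in> sets M" for k by simp
  have two: "2 * (2::ennreal) ^ k = 2 * ennreal (2 ^ k)" for k :: nat
    by (simp add: ennreal_power flip: ennreal_numeral)
  have "(\<integral>\<^sup>+x\<in>B. ?Mg x epowr \<tau> \<partial>M) \<le>
      (\<integral>\<^sup>+x. ennreal (4 powr \<tau>) * (indicator B x + (\<Sum>k. ennreal ((2 powr \<tau>) ^ k) * indicator (E k) x)) \<partial>M)"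
  proof (rule nn_integral_mono)
    fix x
    show "?Mg x epowr \<tau> * indicator B x \<le>
        ennreal (4 powr \<tau>) * (indicator B x + (\<Sum>k. ennreal ((2 powr \<tau>) ^ k) * indicator (E k) x))"
    proof (cases "x \<in> B")
      case True
      then have "(if 2 * 2 ^ k < ?Mg x then 1 else 0) = (indicator (E k) x :: ennreal)" for k
        by (simp add: E_def two)
      with True show ?thesis
        using epowr_le_dyadic_sum[of \<tau> "?Mg x"] \<tau> by simp
    qed simp
  qed
  also have "\<dots> = ennreal (4 powr \<tau>) * (emeasure M B + (\<Sum>k. ennreal ((2 powr \<tau>) ^ k) * emeasure M (E k)))"
    by (simp add: nn_integral_cmult nn_integral_add nn_integral_suminf)
  also have "(\<Sum>k. ennreal ((2 powr \<tau>) ^ k) * emeasure M (E k)) \<le>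
      (\<Sum>k. \<integral>\<^sup>+y. ennreal (2 ^ CARD('n)) * (ennreal (c ^ k) * (ennreal (g y) * (if 2 ^ k < g y then 1 else 0))) \<partial>M)"
  proof (intro suminf_le summableI)
    fix k
    let ?I = "\<integral>\<^sup>+y. ennreal (g y) * (if 2 ^ k < g y then 1 else 0) \<partial>M"
    have "ennreal ((2 powr \<tau>) ^ k) * emeasure M (E k) \<le> ennreal ((2 powr \<tau>) ^ k) * (ennreal (2 ^ CARD('n) / 2 ^ k) * ?I)"
      unfolding E_def using assms by (intro mult_left_mono centered_maximal_weak_type_truncated) auto
    also have "\<dots> = ennreal ((2 powr \<tau>) ^ k * (2 ^ CARD('n) / 2 ^ k)) * ?I"
      by (simp add: mult.assoc[symmetric] flip: ennreal_mult)
    also have "(2 powr \<tau>) ^ k * (2 ^ CARD('n) / 2 ^ k) = 2 ^ CARD('n) * c ^ k"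
      by (simp add: c_def powr_diff power_divide)
    also have "ennreal (2 ^ CARD('n) * c ^ k) * ?I =
      (\<integral>\<^sup>+y. ennreal (2 ^ CARD('n)) * (ennreal (c ^ k) * (ennreal (g y) * (if 2 ^ k < g y then 1 else 0))) \<partial>M)"
      using c by (simp add: nn_integral_cmult ennreal_mult mult.assoc)
    finally show "ennreal ((2 powr \<tau>) ^ k) * emeasure M (E k) \<le>
      (\<integral>\<^sup>+y. ennreal (2 ^ CARD('n)) * (ennreal (c ^ k) * (ennreal (g y) * (if 2 ^ k < g y then 1 else 0))) \<partial>M)" .
  qed
  also have "\<dots> = (\<integral>\<^sup>+y. (\<Sum>k. ennreal (2 ^ CARD('n)) * (ennreal (c ^ k) * (ennreal (g y) * (if 2 ^ k < g y then 1 else 0)))) \<partial>M)"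
    by (rule nn_integral_suminf[symmetric]) measurable
  also have "\<dots> \<le> (\<integral>\<^sup>+y. ennreal (2 ^ CARD('n) * (c / (c - 1))) * ennreal (g y powr \<tau>) \<partial>M)"
  proof (rule nn_integral_mono)
    fix y
    have "(\<Sum>k<n. ennreal (2 ^ CARD('n)) * (ennreal (c ^ k) * (ennreal (g y) * (if 2 ^ k < g y then 1 else 0))))
        \<le> ennreal (2 ^ CARD('n) * (c / (c - 1))) * ennreal (g y powr \<tau>)" for n
    proof -
      have "(\<Sum>k<n. ennreal (2 ^ CARD('n)) * (ennreal (c ^ k) * (ennreal (g y) * (if 2 ^ k < g y then 1 else 0))))
          = (\<Sum>k<n. ennreal (2 ^ CARD('n) * (c ^ k * (g y * (if 2 ^ k < g y then 1 else 0)))))"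
        using c g by (intro sum.cong) (auto simp: ennreal_mult)
      also have "\<dots> = ennreal (\<Sum>k<n. 2 ^ CARD('n) * (c ^ k * (g y * (if 2 ^ k < g y then 1 else 0))))"
        using c g by (intro sum_ennreal) auto
      also have "(\<Sum>k<n. 2 ^ CARD('n) * (c ^ k * (g y * (if 2 ^ k < g y then 1 else 0))))
          = 2 ^ CARD('n) * g y * (\<Sum>k<n. c ^ k * (if 2 ^ k < g y then 1 else 0))"
        unfolding sum_distrib_left by (intro sum.cong) auto
      also have "\<dots> \<le> 2 ^ CARD('n) * g y * (c / (c - 1) * g y powr (\<tau> - 1))"
        using truncated_geometric_sum_le[of "\<tau> - 1" "g y" n] \<tau> g(2)[of y]
        by (intro mult_left_mono) (auto simp: c_def)
      also have "\<dots> = 2 ^ CARD('n) * (c / (c - 1)) * (g y * g y powr (\<tau> - 1))"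
        by simp
      also have "g y * g y powr (\<tau> - 1) = g y powr \<tau>"
        using g(2)[of y] by (cases "g y = 0") (auto simp: powr_diff)
      finally show ?thesis
        using c by (simp add: ennreal_leI flip: ennreal_mult)
    qed
    then show "(\<Sum>k. ennreal (2 ^ CARD('n)) * (ennreal (c ^ k) * (ennreal (g y) * (if 2 ^ k < g y then 1 else 0))))
        \<le> ennreal (2 ^ CARD('n) * (c / (c - 1))) * ennreal (g y powr \<tau>)"
      by (intro suminf_le_const summableI)
  qed
  also have "\<dots> = ennreal (2 ^ CARD('n) * (c / (c - 1))) * (\<integral>\<^sup>+y. ennreal (g y powr \<tau>) \<partial>M)"
    by (intro nn_integral_cmult) measurable
  finally show ?thesis
    by (simp add: c_def add_left_mono mult_left_mono)
qed

end

section \<open>Hoelder inequalities for Muckenhoupt weights\<close>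

lemma Hoelder_nn_integral:
  fixes u v :: "'a \<Rightarrow> real"
  assumes ab: "1 < a" "1 < b" "1 / a + 1 / b = 1"
    and [measurable]: "u \<in> borel_measurable M" "v \<in> borel_measurable M"
    and nonneg: "\<And>x. 0 \<le> u x" "\<And>x. 0 \<le> v x" and pos: "0 < X" "0 < Y"
    and X: "(\<integral>\<^sup>+x. ennreal (u x powr a) \<partial>M) \<le> ennreal X"
    and Y: "(\<integral>\<^sup>+x. ennreal (v x powr b) \<partial>M) \<le> ennreal Y"
  shows "(\<integral>\<^sup>+x. ennreal (u x * v x) \<partial>M) \<le> ennreal (X powr (1 / a) * Y powr (1 / b))"
proof -
  define Z where "Z = X powr (1 / a) * Y powr (1 / b)"
  have "u x * v x \<le> Z / (a * X) * u x powr a + Z / (b * Y) * v x powr b" for x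
  proof -
    have "(u x / X powr (1 / a)) * (v x / Y powr (1 / b)) \<le>
        (u x / X powr (1 / a)) powr a / a + (v x / Y powr (1 / b)) powr b / b"
      using ab nonneg by (intro Youngs_inequality) auto
    also have "(u x / X powr (1 / a)) powr a = u x powr a / X"
      using ab pos nonneg by (simp add: powr_divide powr_powr)
    also have "(v x / Y powr (1 / b)) powr b = v x powr b / Y"
      using ab pos nonneg by (simp add: powr_divide powr_powr)
    finally have "Z * ((u x / X powr (1 / a)) * (v x / Y powr (1 / b))) \<le>
        Z * (u x powr a / X / a + v x powr b / Y / b)"
      by (intro mult_left_mono) (auto simp: Z_def)
    moreover have "Z * ((u x / X powr (1 / a)) * (v x / Y powr (1 / b))) = u x * v x"
      using pos by (simp add: Z_def)
    ultimately show ?thesis by (simp add: algebra_simps)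
  qed
  then have "(\<integral>\<^sup>+x. ennreal (u x * v x) \<partial>M) \<le>
      (\<integral>\<^sup>+x. ennreal (Z / (a * X)) * ennreal (u x powr a) + ennreal (Z / (b * Y)) * ennreal (v x powr b) \<partial>M)"
    using ab pos by (intro nn_integral_mono)
      (simp add: Z_def ennreal_leI flip: ennreal_mult ennreal_plus)
  also have "\<dots> = ennreal (Z / (a * X)) * (\<integral>\<^sup>+x. ennreal (u x powr a) \<partial>M) +
      ennreal (Z / (b * Y)) * (\<integral>\<^sup>+x. ennreal (v x powr b) \<partial>M)"
    by (simp add: nn_integral_add nn_integral_cmult)
  also have "\<dots> \<le> ennreal (Z / (a * X)) * ennreal X + ennreal (Z / (b * Y)) * ennreal Y"
    using X Y by (intro add_mono mult_left_mono) auto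
  also have "\<dots> = ennreal (Z / (a * X) * X + Z / (b * Y) * Y)"
    using ab pos by (simp add: Z_def flip: ennreal_mult ennreal_plus)
  also have "Z / (a * X) * X + Z / (b * Y) * Y = Z * (1 / a + 1 / b)"
    using pos by (simp add: algebra_simps)
  finally show ?thesis using ab by (simp add: Z_def)
qed

lemma Jensen_powr_nn_integral:
  fixes g :: "'a \<Rightarrow> real"
  assumes \<kappa>: "0 < \<kappa>" "\<kappa> \<le> 1" and [measurable]: "g \<in> borel_measurable M" "Q \<in> sets M"
    and g: "\<And>x. 0 \<le> g x" and pos: "0 < N" "0 < S"
    and N: "emeasure M Q \<le> ennreal N" and S: "(\<integral>\<^sup>+x\<in>Q. ennreal (g x) \<partial>M) \<le> ennreal S"
  shows "(\<integral>\<^sup>+x\<in>Q. ennreal (g x powr \<kappa>) \<partial>M) \<le> ennreal (N powr (1 - \<kappa>) * S powr \<kappa>)"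
proof (cases "\<kappa> = 1")
  case True
  then show ?thesis using S g pos by simp
next
  case False
  let ?u = "\<lambda>x. g x powr \<kappa> * indicator Q x" and ?v = "\<lambda>x. indicator Q x"
  have "(\<integral>\<^sup>+x. ennreal (?u x powr (1 / \<kappa>)) \<partial>M) = (\<integral>\<^sup>+x\<in>Q. ennreal (g x) \<partial>M)"
    using \<kappa> g by (intro nn_integral_cong) (auto simp: powr_powr indicator_def)
  moreover have "(\<integral>\<^sup>+x. ennreal (?v x powr (1 / (1 - \<kappa>))) \<partial>M) = (\<integral>\<^sup>+x. indicator Q x \<partial>M)"
    by (intro nn_integral_cong) (auto simp: indicator_def)
  ultimately have "(\<integral>\<^sup>+x. ennreal (?u x * ?v x) \<partial>M) \<le>
      ennreal (S powr (1 / (1 / \<kappa>)) * N powr (1 / (1 / (1 - \<kappa>))))"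
    using \<kappa> False pos S N by (intro Hoelder_nn_integral) auto
  moreover have "(\<integral>\<^sup>+x. ennreal (?u x * ?v x) \<partial>M) = (\<integral>\<^sup>+x\<in>Q. ennreal (g x powr \<kappa>) \<partial>M)"
    by (intro nn_integral_cong) (auto simp: indicator_def)
  ultimately show ?thesis by (simp add: mult.commute)
qed

text \<open>Exponent bookkeeping: \<open>N\<close> is the \<open>\<nu>\<close>-measure of a cube and \<open>S\<close> the integral of \<open>g\<close> over it.
  The a priori bound for \<open>S\<close> is spent on exactly that power of \<open>S\<close> which turns the remaining powers
  of \<open>N\<close> and \<open>S\<close> into a power of the mean \<open>S / N\<close>.\<close>

lemma mean_value_power_balance:
  fixes N S K a b P \<tau> \<theta> :: real
  assumes pos: "0 < N" "0 < S" "0 < K" "0 < a" "0 < P" "1 < \<tau>" "0 \<le> \<theta>" and ab: "1 / a = 1 / b + \<theta>"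
    and S: "S \<le> N powr (1 - 1 / \<tau>) * K powr (1 / \<tau>)"
  shows "N powr (- (1 / b)) * (N powr (1 - a * \<tau> / P) * S powr (a * \<tau> / P)) powr (1 / a)
    \<le> K powr \<theta> * (S / N) powr (\<tau> * (1 / P - \<theta>))"
proof -
  have "S powr (\<tau> * \<theta>) \<le> (N powr (1 - 1 / \<tau>) * K powr (1 / \<tau>)) powr (\<tau> * \<theta>)"
    using S pos by (intro powr_mono2) auto
  also have "\<dots> = N powr ((\<tau> - 1) * \<theta>) * K powr \<theta>"
  proof -
    have "(1 - 1 / \<tau>) * (\<tau> * \<theta>) = (\<tau> - 1) * \<theta>" "1 / \<tau> * (\<tau> * \<theta>) = \<theta>"
      using pos by (simp_all add: field_simps)
    then show ?thesis using pos by (simp only: powr_mult powr_powr powr_ge_zero)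
  qed
  finally have S': "S powr (\<tau> * \<theta>) \<le> N powr ((\<tau> - 1) * \<theta>) * K powr \<theta>" .
  have "N powr (- (1 / b)) * (N powr (1 - a * \<tau> / P) * S powr (a * \<tau> / P)) powr (1 / a)
      = N powr (- (1 / b)) * (N powr (1 / a - \<tau> / P) * S powr (\<tau> / P))"
    using pos by (simp add: powr_mult powr_powr field_simps)
  also have "\<dots> = N powr (\<theta> - \<tau> / P) * S powr (\<tau> / P)"
    using ab by (simp add: mult.assoc[symmetric] flip: powr_add)
  also have "S powr (\<tau> / P) = S powr (\<tau> * (1 / P - \<theta>)) * S powr (\<tau> * \<theta>)"
    by (simp add: algebra_simps flip: powr_add)
  also have "N powr (\<theta> - \<tau> / P) * (S powr (\<tau> * (1 / P - \<theta>)) * S powr (\<tau> * \<theta>)) \<le>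
      N powr (\<theta> - \<tau> / P) * (S powr (\<tau> * (1 / P - \<theta>)) * (N powr ((\<tau> - 1) * \<theta>) * K powr \<theta>))"
    by (intro mult_left_mono S') auto
  also have "\<dots> = K powr \<theta> * (S powr (\<tau> * (1 / P - \<theta>)) * (N powr (\<theta> - \<tau> / P) * N powr ((\<tau> - 1) * \<theta>)))"
    by simp
  also have "N powr (\<theta> - \<tau> / P) * N powr ((\<tau> - 1) * \<theta>) = N powr (- (\<tau> * (1 / P - \<theta>)))"
    by (simp add: algebra_simps flip: powr_add)
  also have "S powr (\<tau> * (1 / P - \<theta>)) * N powr (- (\<tau> * (1 / P - \<theta>))) = (S / N) powr (\<tau> * (1 / P - \<theta>))"
    using pos by (simp add: powr_divide powr_minus_divide)
  finally show ?thesis .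
qed

text \<open>Passing from the smallest conjugate exponent \<open>Q\<close> on a cube of measure \<open>m\<close> to the exponent
  \<open>q\<close> at its center costs a power \<open>R\<^bsup>q-Q\<^esup>\<close>, which is absorbed by the a priori bound for \<open>R\<close> and
  the local continuity of the exponent.\<close>

lemma exponent_at_center:
  fixes R m X \<tau> p P q Q \<theta> qs C B K :: real
  assumes "0 \<le> R" "0 < m" "0 \<le> X" "0 \<le> \<theta>" "\<theta> < 1"
    and exps: "1 \<le> P" "P \<le> p" "1 / q = 1 / p - \<theta>" "1 / Q = 1 / P - \<theta>" "0 < q" "q \<le> qs"
    and R1: "R \<le> C * X powr (\<tau> / Q)" and R2: "R \<le> B * (1 / m) powr (1 - \<theta>)"
    and K: "(1 / m) powr (p - P) \<le> K" "1 \<le> K" "1 \<le> C" "1 \<le> B"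
  shows "R powr q \<le> C powr qs * B powr qs * K powr (qs * qs) * X powr \<tau>"
proof -
  have "1 / p \<le> 1 / P" using exps by (intro divide_left_mono) auto
  then have "1 / q \<le> 1 / Q" using exps by linarith
  moreover have "0 < 1 / q" by (metis exps(5) zero_less_divide_1_iff)
  ultimately have "0 < 1 / Q" by linarith
  then have "0 < Q" by simp
  have Qq: "Q \<le> q"
    using \<open>1 / q \<le> 1 / Q\<close> exps(5) inverse_le_imp_le[of q Q] by (simp add: inverse_eq_divide)
  have "q - Q = q * Q * (1 / Q - 1 / q)" using exps \<open>0 < Q\<close> by (simp add: field_simps)
  also have "1 / Q - 1 / q = 1 / P - 1 / p" using exps by simp
  also have "\<dots> = (p - P) * (1 / (p * P))" using exps by (simp add: field_simps)
  also have "q * Q * ((p - P) * (1 / (p * P))) \<le> qs * qs * ((p - P) * 1)"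
  proof (intro mult_mono)
    have "1 * 1 \<le> p * P" using exps by (intro mult_mono) auto
    then show "1 / (p * P) \<le> 1" by simp
  qed (use exps \<open>0 < Q\<close> Qq in auto)
  finally have d: "q - Q \<le> qs * qs * (p - P)" by simp
  have "R powr (q - Q) \<le> (B * (1 / m) powr (1 - \<theta>)) powr (q - Q)"
    using R2 Qq assms(1) by (intro powr_mono2) auto
  also have "\<dots> = B powr (q - Q) * (1 / m) powr ((1 - \<theta>) * (q - Q))"
    using K assms(2) by (simp add: powr_mult powr_powr)
  also have "\<dots> \<le> B powr qs * K powr (qs * qs)"
  proof (intro mult_mono)
    show "B powr (q - Q) \<le> B powr qs"
      using K exps \<open>0 < Q\<close> by (intro powr_mono) auto
    show "(1 / m) powr ((1 - \<theta>) * (q - Q)) \<le> K powr (qs * qs)"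
    proof (cases "1 \<le> 1 / m")
      case True
      have "(1 - \<theta>) * (q - Q) \<le> 1 * (q - Q)"
        using Qq assms(4) by (intro mult_right_mono) auto
      then have "(1 / m) powr ((1 - \<theta>) * (q - Q)) \<le> (1 / m) powr ((p - P) * (qs * qs))"
        using True d by (intro powr_mono) (auto simp: mult.commute)
      also have "\<dots> = ((1 / m) powr (p - P)) powr (qs * qs)"
        by (simp add: powr_powr)
      also have "\<dots> \<le> K powr (qs * qs)"
        using K exps by (intro powr_mono2) auto
      finally show ?thesis .
    next
      case False
      then have "(1 / m) powr ((1 - \<theta>) * (q - Q)) \<le> 1"
        using assms(2,5) Qq by (intro powr_le1) auto
      also have "1 \<le> K powr (qs * qs)"
        using K exps by (intro ge_one_powr_ge_zero) auto
      finally show ?thesis .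
    qed
  qed auto
  finally have 2: "R powr (q - Q) \<le> B powr qs * K powr (qs * qs)" .
  have "R powr Q \<le> (C * X powr (\<tau> / Q)) powr Q"
    using R1 assms(1) \<open>0 < Q\<close> by (intro powr_mono2) auto
  also have "\<dots> = C powr Q * X powr \<tau>"
    using K \<open>0 < Q\<close> by (simp add: powr_mult powr_powr)
  also have "\<dots> \<le> C powr qs * X powr \<tau>"
    using K exps Qq by (intro mult_right_mono powr_mono) auto
  finally have 1: "R powr Q \<le> C powr qs * X powr \<tau>" .
  have "R powr q = R powr Q * R powr (q - Q)"
    by (simp flip: powr_add)
  also have "\<dots> \<le> (C powr qs * X powr \<tau>) * (B powr qs * K powr (qs * qs))"
    using 1 2 by (intro mult_mono) auto
  finally show ?thesis by (simp add: mult_ac)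
qed

section \<open>The modular inequality\<close>

text \<open>The number \<open>Y\<close> bounds the integral of the dual weight over a cube: stating the
  Muckenhoupt condition through it keeps the dual integral finite.  The measure \<open>\<nu> = V \<mu>\<close> on \<open>\<Omega>\<close> is
  finite but in general not doubling.\<close>

locale muckenhoupt_weight =
  fixes \<mu> :: "(real ^ 'n) measure" and \<Omega> :: "(real ^ 'n) set" and V :: "real ^ 'n \<Rightarrow> real"
    and \<sigma> \<theta> A :: real
  assumes borel_subset: "sets borel \<subseteq> sets \<mu>" and space_UNIV: "space \<mu> = UNIV"
    and Omega [measurable]: "\<Omega> \<in> sets \<mu>" and bounded_Omega: "bounded \<Omega>"
    and cube_finite: "\<And>x l. x \<in> \<Omega> \<Longrightarrow> 0 < l \<Longrightarrow> emeasure \<mu> (cube x l) < top"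
    and V [measurable]: "V \<in> borel_measurable \<mu>" and V_pos: "\<And>x. 0 < V x"
    and \<sigma>: "1 < \<sigma>" and \<theta>: "0 \<le> \<theta>" "\<theta> < 1" and A: "1 \<le> A"
    and weight_finite: "(\<integral>\<^sup>+x. ennreal (V x) * indicator \<Omega> x \<partial>\<mu>) < top"
    and Muckenhoupt: "\<And>x l. x \<in> \<Omega> \<Longrightarrow> 0 < l \<Longrightarrow>
      \<exists>Y\<ge>0. (\<integral>\<^sup>+y\<in>cube x l \<inter> \<Omega>. ennreal (V y powr (- (1 / (\<sigma> - 1)))) \<partial>\<mu>) \<le> ennreal Y \<and>
        enn2real (\<integral>\<^sup>+y\<in>cube x l \<inter> \<Omega>. ennreal (V y) \<partial>\<mu>) * Y powr (\<sigma> - 1)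
          \<le> A * measure \<mu> (cube x l) powr \<sigma>"
begin

definition nu :: "(real ^ 'n) measure" where
  "nu = density \<mu> (\<lambda>x. ennreal (V x) * indicator \<Omega> x)"

lemma sets_nu [simp, measurable_cong]: "sets nu = sets \<mu>"
  by (simp add: nu_def)

lemma cube_sets' [measurable, simp]: "cube x r \<in> sets \<mu>"
  using cube_borel borel_subset by blast

lemma nn_integral_nu:
  "h \<in> borel_measurable \<mu> \<Longrightarrow> (\<integral>\<^sup>+x. h x \<partial>nu) = (\<integral>\<^sup>+x\<in>\<Omega>. ennreal (V x) * h x \<partial>\<mu>)"
  unfolding nu_def by (simp add: nn_integral_density mult_ac)

lemma emeasure_nu: "Q \<in> sets \<mu> \<Longrightarrow> emeasure nu Q = (\<integral>\<^sup>+y\<in>Q \<inter> \<Omega>. ennreal (V y) \<partial>\<mu>)"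
  unfolding nu_def by (subst emeasure_density) (auto simp: indicator_inter_arith mult_ac intro!: nn_integral_cong)

sublocale nu: finite_borel_measure nu
proof (intro finite_borel_measure.intro finite_measureI finite_borel_measure_axioms.intro)
  have "emeasure nu (space nu) = (\<integral>\<^sup>+x. ennreal (V x) * indicator \<Omega> x \<partial>\<mu>)"
    using space_UNIV sets.top[of \<mu>] by (subst emeasure_nu) (auto simp: nu_def)
  then show "emeasure nu (space nu) \<noteq> \<infinity>"
    using weight_finite by simp
qed (use borel_subset space_UNIV in \<open>auto simp: nu_def\<close>)

lemma nn_integral_nu_mono:
  assumes "\<And>y. y \<in> Q \<Longrightarrow> y \<in> \<Omega> \<Longrightarrow> h y \<le> k y"
  shows "(\<integral>\<^sup>+y\<in>Q. h y \<partial>nu) \<le> (\<integral>\<^sup>+y\<in>Q. k y \<partial>nu)"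
proof (rule nn_integral_mono_AE)
  have "AE y in nu. y \<in> \<Omega>"
    unfolding nu_def by (subst AE_density) (auto simp: indicator_def)
  then show "AE y in nu. h y * indicator Q y \<le> k y * indicator Q y"
    by eventually_elim (use assms in \<open>auto simp: indicator_def\<close>)
qed

lemma nu_null_imp_integral_zero:
  assumes "Q \<in> sets \<mu>" "emeasure nu Q = 0"
  shows "(\<integral>\<^sup>+y\<in>Q \<inter> \<Omega>. h y \<partial>\<mu>) = 0"
proof (rule nn_integral_null_set)
  have "Q \<in> null_sets nu" using assms by auto
  then have "AE y in \<mu>. y \<in> Q \<longrightarrow> ennreal (V y) * indicator \<Omega> y = 0"
    unfolding nu_def by (subst (asm) null_sets_density_iff) auto
  then have "AE y in \<mu>. y \<notin> Q \<inter> \<Omega>"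
    by eventually_elim (use V_pos in \<open>auto simp: indicator_def not_le[symmetric] ennreal_eq_0_iff\<close>)
  then show "Q \<inter> \<Omega> \<in> null_sets \<mu>"
    using assms(1) by (subst AE_iff_null_sets) auto
qed

text \<open>The exponents with \<open>b (1 - \<theta>) = \<sigma>\<close> and \<open>1 / a = 1 / b + \<theta>\<close> are those for which the classical
  off-diagonal Muckenhoupt condition for \<open>L^a \<rightarrow> L^b\<close> is the condition \<open>A_\<sigma>\<close> on \<open>V\<close>.\<close>

definition b :: real where "b = \<sigma> / (1 - \<theta>)"
definition a :: real where "a = 1 / (1 / b + \<theta>)"

lemma b_pos: "0 < b"
  using \<sigma> \<theta> by (simp add: b_def)

lemma inverse_a: "1 / a = 1 / b + \<theta>"
  by (simp add: a_def)

lemma a_conjugate: "1 / a + (\<sigma> - 1) / b = 1"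
  using \<sigma> \<theta> by (simp add: inverse_a b_def field_simps)

lemma a_gt_1: "1 < a"
proof -
  have "0 < (\<sigma> - 1) / b" "0 < 1 / b" using b_pos \<sigma> by auto
  then have "1 / a < 1" "0 < 1 / a"
    using a_conjugate inverse_a \<theta> by linarith+
  then show ?thesis by (simp add: divide_less_eq_1 split: if_splits)
qed

text \<open>Write \<open>V^\<theta> = V^(1/a) V^(-1/b)\<close> and apply Hoelder's inequality with \<open>a\<close>.  The conjugate power of
  \<open>V^(-1/b)\<close> is the dual weight, which the Muckenhoupt condition trades for the measures of the
  cube.\<close>

lemma fractional_average_Hoelder:
  assumes x: "x \<in> \<Omega>" "0 < l" and N: "0 < measure nu (cube x l)"
    and [measurable]: "G \<in> borel_measurable \<mu>" and G: "\<And>y. 0 \<le> G y" and X: "0 < X"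
    "(\<integral>\<^sup>+y\<in>cube x l. ennreal (G y powr a) \<partial>nu) \<le> ennreal X"
  shows "(\<integral>\<^sup>+y\<in>cube x l \<inter> \<Omega>. ennreal (G y * V y powr \<theta>) \<partial>\<mu>) \<le>
    ennreal (A powr (1 / b) * measure \<mu> (cube x l) powr (1 - \<theta>) *
      (measure nu (cube x l) powr (- (1 / b)) * X powr (1 / a)))"
proof -
  let ?Q = "cube x l"
  let ?N = "measure nu ?Q" and ?m = "measure \<mu> ?Q"
  define W where "W y = V y powr (- (1 / (\<sigma> - 1)))" for y
  have [measurable]: "W \<in> borel_measurable \<mu>" unfolding W_def by measurable
  have W_pos: "0 < W y" for y using V_pos[of y] by (simp add: W_def)
  obtain Y where Y: "0 \<le> Y" "(\<integral>\<^sup>+y\<in>?Q \<inter> \<Omega>. ennreal (W y) \<partial>\<mu>) \<le> ennreal Y"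
    "enn2real (\<integral>\<^sup>+y\<in>?Q \<inter> \<Omega>. ennreal (V y) \<partial>\<mu>) * Y powr (\<sigma> - 1) \<le> A * ?m powr \<sigma>"
    using Muckenhoupt[OF x] unfolding W_def by blast
  have NY: "?N * Y powr (\<sigma> - 1) \<le> A * ?m powr \<sigma>"
    using Y(3) by (simp add: measure_def emeasure_nu)
  have "Y \<noteq> 0"
  proof
    assume "Y = 0"
    then have "AE y in \<mu>. ennreal (W y) * indicator (?Q \<inter> \<Omega>) y = 0"
      using Y(2) by (subst nn_integral_0_iff_AE[symmetric]) auto
    then have "AE y in \<mu>. ennreal (V y) * indicator (?Q \<inter> \<Omega>) y = 0"
      by eventually_elim (use W_pos in \<open>auto simp: indicator_def ennreal_eq_0_iff not_le[symmetric]\<close>)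
    then have "emeasure nu ?Q = 0"
      by (simp add: emeasure_nu nn_integral_0_iff_AE)
    with N show False by (simp add: measure_def)
  qed
  with Y(1) have "0 < Y" by simp
  let ?u = "\<lambda>y. G y * V y powr (1 / a) * indicator (?Q \<inter> \<Omega>) y"
  let ?v = "\<lambda>y. V y powr (- (1 / b)) * indicator (?Q \<inter> \<Omega>) y"
  have "(\<integral>\<^sup>+y. ennreal (?u y powr a) \<partial>\<mu>) = (\<integral>\<^sup>+y\<in>?Q. ennreal (G y powr a) \<partial>nu)"
    using a_gt_1 G V_pos
    by (subst nn_integral_nu) (auto simp: powr_mult powr_powr indicator_def mult_ac less_imp_le
        simp flip: ennreal_mult intro!: nn_integral_cong)
  then have u: "(\<integral>\<^sup>+y. ennreal (?u y powr a) \<partial>\<mu>) \<le> ennreal X" using X by simp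
  have "(\<integral>\<^sup>+y. ennreal (?v y powr (b / (\<sigma> - 1))) \<partial>\<mu>) = (\<integral>\<^sup>+y\<in>?Q \<inter> \<Omega>. ennreal (W y) \<partial>\<mu>)"
    using b_pos \<sigma> by (auto simp: W_def powr_powr indicator_def intro!: nn_integral_cong)
  then have v: "(\<integral>\<^sup>+y. ennreal (?v y powr (b / (\<sigma> - 1))) \<partial>\<mu>) \<le> ennreal Y" using Y by simp
  have "0 < 1 / a" using a_gt_1 by simp
  then have "(\<sigma> - 1) / b < 1" using a_conjugate by linarith
  then have b': "1 < b / (\<sigma> - 1)" using b_pos \<sigma> by (simp add: field_simps)
  have "(\<integral>\<^sup>+y\<in>?Q \<inter> \<Omega>. ennreal (G y * V y powr \<theta>) \<partial>\<mu>) = (\<integral>\<^sup>+y. ennreal (?u y * ?v y) \<partial>\<mu>)"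
  proof (rule nn_integral_cong)
    fix y
    have "V y powr (1 / a) * V y powr (- (1 / b)) = V y powr \<theta>"
      by (simp add: inverse_a flip: powr_add)
    then show "ennreal (G y * V y powr \<theta>) * indicator (?Q \<inter> \<Omega>) y = ennreal (?u y * ?v y)"
      by (simp add: indicator_def mult.assoc)
  qed
  also have "\<dots> \<le> ennreal (X powr (1 / a) * Y powr (1 / (b / (\<sigma> - 1))))"
    using a_gt_1 b' a_conjugate G X(1) \<open>0 < Y\<close> u v by (intro Hoelder_nn_integral) auto
  also have "\<dots> \<le> ennreal (A powr (1 / b) * ?m powr (1 - \<theta>) * (?N powr (- (1 / b)) * X powr (1 / a)))"
  proof (rule ennreal_leI)
    have "Y powr (\<sigma> - 1) \<le> A * ?m powr \<sigma> / ?N"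
      using NY N by (simp add: field_simps)
    then have "(Y powr (\<sigma> - 1)) powr (1 / b) \<le> (A * ?m powr \<sigma> / ?N) powr (1 / b)"
      using b_pos by (intro powr_mono2) auto
    moreover have "(Y powr (\<sigma> - 1)) powr (1 / b) = Y powr (1 / (b / (\<sigma> - 1)))"
      by (simp add: powr_powr)
    moreover have "(A * ?m powr \<sigma> / ?N) powr (1 / b) =
        A powr (1 / b) * ?m powr (1 - \<theta>) * ?N powr (- (1 / b))"
    proof -
      have "\<sigma> * (1 / b) = 1 - \<theta>" using \<sigma> \<theta> by (simp add: b_def)
      then show ?thesis
        using A N by (simp add: powr_mult powr_divide powr_powr powr_minus_divide)
    qed
    ultimately have "Y powr (1 / (b / (\<sigma> - 1))) \<le> A powr (1 / b) * ?m powr (1 - \<theta>) * ?N powr (- (1 / b))"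
      by simp
    then have "X powr (1 / a) * Y powr (1 / (b / (\<sigma> - 1))) \<le>
        X powr (1 / a) * (A powr (1 / b) * ?m powr (1 - \<theta>) * ?N powr (- (1 / b)))"
      by (intro mult_left_mono) auto
    then show "X powr (1 / a) * Y powr (1 / (b / (\<sigma> - 1))) \<le>
        A powr (1 / b) * ?m powr (1 - \<theta>) * (?N powr (- (1 / b)) * X powr (1 / a))"
      by (simp add: mult_ac)
  qed
  finally show ?thesis .
qed

end

text \<open>The gap \<open>a < ps\<close> leaves room for a maximal theorem with exponent \<open>\<tau> = ps / a > 1\<close>.  The assumption
  \<open>local_exponent\<close> is what log-Hoelder continuity and lower regularity of \<open>\<mu>\<close> give together.\<close>

locale variable_exponent_weight = muckenhoupt_weight \<mu> \<Omega> V \<sigma> \<theta> A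
  for \<mu> :: "(real ^ 'n) measure" and \<Omega> V \<sigma> \<theta> A +
  fixes p q :: "real ^ 'n \<Rightarrow> real" and ps qs K :: real
  assumes p [measurable]: "p \<in> borel_measurable \<mu>"
    and ps: "a < ps" "\<And>y. y \<in> \<Omega> \<Longrightarrow> ps \<le> p y"
    and q: "\<And>y. y \<in> \<Omega> \<Longrightarrow> 1 / q y = 1 / p y - \<theta>" "\<And>y. y \<in> \<Omega> \<Longrightarrow> 0 < q y"
      "\<And>y. y \<in> \<Omega> \<Longrightarrow> q y \<le> qs"
    and K: "1 \<le> K"
    and local_exponent: "\<And>x l. x \<in> \<Omega> \<Longrightarrow> 0 < l \<Longrightarrow>
      \<exists>P. ps \<le> P \<and> P \<le> p x \<and> (\<forall>y\<in>cube x l \<inter> \<Omega>. P \<le> p y) \<and>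
        (1 / measure \<mu> (cube x l)) powr (p x - P) \<le> K"
begin

definition \<tau> :: real where "\<tau> = ps / a"

lemma \<tau>_gt_1: "1 < \<tau>"
  using ps a_gt_1 by (simp add: \<tau>_def)

lemma p_ge_1: "y \<in> \<Omega> \<Longrightarrow> 1 \<le> p y"
  using ps a_gt_1 by fastforce

definition K0 :: real where "K0 = 1 + measure nu \<Omega>"

lemma K0_ge_1: "1 \<le> K0"
  by (simp add: K0_def)

definition admissible :: "(real ^ 'n \<Rightarrow> real) \<Rightarrow> bool" where
  "admissible F \<longleftrightarrow> F \<in> borel_measurable \<mu> \<and> (\<forall>y. 0 \<le> F y) \<and>
    (\<integral>\<^sup>+y\<in>\<Omega>. ennreal (V y * (F y * V y powr (- \<theta>)) powr p y) \<partial>\<mu>) \<le> 1"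

text \<open>With \<open>F = G V\<^bsup>\<theta>\<^esup>\<close> the weighted modular of \<open>F\<close> becomes that of \<open>G\<close> with respect to \<open>\<nu>\<close>.  Replacing
  \<open>G\<close> by \<open>H = max 1 G\<close> makes its powers increase with the exponent, and costs only \<open>\<nu> \<Omega>\<close>.\<close>

definition H :: "(real ^ 'n \<Rightarrow> real) \<Rightarrow> real ^ 'n \<Rightarrow> real" where
  "H F y = max 1 (F y * V y powr (- \<theta>))"

text \<open>By \<open>g^\<tau> = H^p\<close> the function to which the maximal theorem is applied has bounded norm in
  \<open>L^\<tau>(\<nu>)\<close>.\<close>

definition g :: "(real ^ 'n \<Rightarrow> real) \<Rightarrow> real ^ 'n \<Rightarrow> real" where
  "g F y = H F y powr (p y / \<tau>)"

lemma H_ge_1: "1 \<le> H F y"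
  by (simp add: H_def)

lemma g_nonneg: "0 \<le> g F y"
  by (simp add: g_def)

lemma g_ge_1: "y \<in> \<Omega> \<Longrightarrow> 1 \<le> g F y"
  using H_ge_1[of F y] p_ge_1[of y] \<tau>_gt_1 by (simp add: g_def ge_one_powr_ge_zero)

lemma g_powr: "g F y powr \<tau> = H F y powr p y"
  using \<tau>_gt_1 by (simp add: g_def powr_powr)

lemma le_H: "F y \<le> H F y * V y powr \<theta>"
proof -
  have "F y = F y * V y powr (- \<theta>) * V y powr \<theta>"
    using V_pos[of y] by (simp add: mult.assoc flip: powr_add)
  also have "\<dots> \<le> H F y * V y powr \<theta>"
    by (intro mult_right_mono) (auto simp: H_def)
  finally show ?thesis .
qed

lemma H_measurable [measurable]: "admissible F \<Longrightarrow> H F \<in> borel_measurable \<mu>"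
  unfolding H_def[abs_def] admissible_def by auto

lemma g_measurable [measurable]: "admissible F \<Longrightarrow> g F \<in> borel_measurable \<mu>"
  unfolding g_def[abs_def] by measurable

lemma integral_H_le:
  assumes F: "admissible F"
  shows "(\<integral>\<^sup>+y. ennreal (H F y powr p y) \<partial>nu) \<le> ennreal K0"
proof -
  have [measurable]: "F \<in> borel_measurable \<mu>" and F0: "\<And>y. 0 \<le> F y"
    using F by (auto simp: admissible_def)
  have [measurable]: "H F \<in> borel_measurable \<mu>" using F by measurable
  have "(\<integral>\<^sup>+y. ennreal (H F y powr p y) \<partial>nu) = (\<integral>\<^sup>+y\<in>\<Omega>. ennreal (V y) * ennreal (H F y powr p y) \<partial>\<mu>)"
    by (rule nn_integral_nu) measurable
  also have "\<dots> \<le> (\<integral>\<^sup>+y. ennreal (V y * (F y * V y powr (- \<theta>)) powr p y) * indicator \<Omega> y +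
      ennreal (V y) * indicator \<Omega> y \<partial>\<mu>)"
  proof (rule nn_integral_mono)
    fix y
    have "H F y powr p y \<le> (F y * V y powr (- \<theta>)) powr p y + 1"
      by (cases "F y * V y powr (- \<theta>) \<le> 1") (auto simp: H_def max_def)
    then have "V y * H F y powr p y \<le> V y * ((F y * V y powr (- \<theta>)) powr p y + 1)"
      using V_pos[of y] by (intro mult_left_mono) auto
    then have "ennreal (V y * H F y powr p y) \<le>
        ennreal (V y * (F y * V y powr (- \<theta>)) powr p y) + ennreal (V y)"
      using V_pos[of y] by (simp add: distrib_left flip: ennreal_plus)
    then show "ennreal (V y) * ennreal (H F y powr p y) * indicator \<Omega> y \<le>
        ennreal (V y * (F y * V y powr (- \<theta>)) powr p y) * indicator \<Omega> y + ennreal (V y) * indicator \<Omega> y"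
      using V_pos[of y] by (simp add: indicator_def ennreal_mult)
  qed
  also have "\<dots> = (\<integral>\<^sup>+y\<in>\<Omega>. ennreal (V y * (F y * V y powr (- \<theta>)) powr p y) \<partial>\<mu>) + emeasure nu \<Omega>"
    by (subst nn_integral_add) (auto simp: emeasure_nu)
  also have "\<dots> \<le> 1 + ennreal (measure nu \<Omega>)"
    using F by (auto simp: admissible_def nu.emeasure_eq_measure intro!: add_mono)
  finally show ?thesis
    by (simp add: K0_def ennreal_plus)
qed

lemma fractional_average_le:
  assumes x: "x \<in> \<Omega>" "0 < l" and N: "0 < measure nu (cube x l)" and F: "admissible F" and X: "0 < X"
    "(\<integral>\<^sup>+y\<in>cube x l. ennreal (H F y powr a) \<partial>nu) \<le> ennreal X"
  shows "(\<integral>\<^sup>+y\<in>cube x l \<inter> \<Omega>. ennreal (F y) \<partial>\<mu>) \<le>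
    ennreal (A powr (1 / b) * measure \<mu> (cube x l) powr (1 - \<theta>) *
      (measure nu (cube x l) powr (- (1 / b)) * X powr (1 / a)))"
proof -
  have "(\<integral>\<^sup>+y\<in>cube x l \<inter> \<Omega>. ennreal (F y) \<partial>\<mu>) \<le> (\<integral>\<^sup>+y\<in>cube x l \<inter> \<Omega>. ennreal (H F y * V y powr \<theta>) \<partial>\<mu>)"
    using le_H by (intro nn_integral_mono mult_right_mono ennreal_leI) auto
  also have "\<dots> \<le> ennreal (A powr (1 / b) * measure \<mu> (cube x l) powr (1 - \<theta>) *
      (measure nu (cube x l) powr (- (1 / b)) * X powr (1 / a)))"
    using F X order_trans[OF zero_le_one H_ge_1] by (intro fractional_average_Hoelder x N) auto
  finally show ?thesis .
qed

text \<open>A single cube containing \<open>\<Omega>\<close> gives the a priori bound for all admissible functions.\<close>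

lemma integral_bounded:
  obtains B where "1 \<le> B" "\<And>F. admissible F \<Longrightarrow> (\<integral>\<^sup>+y\<in>\<Omega>. ennreal (F y) \<partial>\<mu>) \<le> ennreal B"
proof (cases "emeasure nu \<Omega> = 0")
  case True
  then have "(\<integral>\<^sup>+y\<in>\<Omega>. ennreal (F y) \<partial>\<mu>) \<le> ennreal 1" for F
    using nu_null_imp_integral_zero[of \<Omega>] by simp
  then show ?thesis by (intro that[of 1]) auto
next
  case False
  then obtain x where x: "x \<in> \<Omega>" by fastforce
  obtain D where D: "0 < D" "\<Omega> \<subseteq> cube x D"
    using bounded_subset_cube[OF bounded_Omega] .
  have N: "0 < measure nu (cube x D)"
  proof -
    have "0 < emeasure nu \<Omega>" using False by (simp add: zero_less_iff_neq_zero)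
    also have "\<dots> \<le> emeasure nu (cube x D)" using D by (intro emeasure_mono) auto
    finally show ?thesis by (simp add: nu.emeasure_eq_measure)
  qed
  define B where "B = A powr (1 / b) * measure \<mu> (cube x D) powr (1 - \<theta>) *
      (measure nu (cube x D) powr (- (1 / b)) * K0 powr (1 / a))"
  have "(\<integral>\<^sup>+y\<in>\<Omega>. ennreal (F y) \<partial>\<mu>) \<le> ennreal (max 1 B)" if F: "admissible F" for F
  proof -
    have "(\<integral>\<^sup>+y\<in>cube x D. ennreal (H F y powr a) \<partial>nu) \<le> (\<integral>\<^sup>+y\<in>cube x D. ennreal (H F y powr p y) \<partial>nu)"
      using H_ge_1 ps by (intro nn_integral_nu_mono ennreal_leI powr_mono) fastforce+
    also have "\<dots> \<le> (\<integral>\<^sup>+y. ennreal (H F y powr p y) \<partial>nu)"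
      by (intro nn_integral_mono) (auto simp: indicator_def)
    also note integral_H_le[OF F]
    finally have "(\<integral>\<^sup>+y\<in>cube x D \<inter> \<Omega>. ennreal (F y) \<partial>\<mu>) \<le> ennreal B"
      unfolding B_def using K0_ge_1 by (intro fractional_average_le x D N F) auto
    moreover have "cube x D \<inter> \<Omega> = \<Omega>" using D by blast
    ultimately show ?thesis by (auto intro: order_trans ennreal_leI)
  qed
  then show ?thesis by (intro that[of "max 1 B"]) auto
qed

text \<open>A fractional mean has two bounds: by the mean of \<open>g\<close>, to the power that belongs to the smallest
  exponent on the cube, and by a power of \<open>1 / \<mu> Q\<close>.  The second one pays for replacing that exponent by
  the one at the center.\<close>

lemma fractional_average_power_le:
  assumes x: "x \<in> \<Omega>" "0 < l" and F: "admissible F"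
    and B: "1 \<le> B" "(\<integral>\<^sup>+y\<in>\<Omega>. ennreal (F y) \<partial>\<mu>) \<le> ennreal B"
  shows "((\<integral>\<^sup>+y\<in>cube x l \<inter> \<Omega>. ennreal (F y) \<partial>\<mu>) / (emeasure \<mu> (cube x l) epowr (1 - \<theta>))) epowr q x \<le>
    ennreal ((A powr (1 / b) * K0 powr \<theta>) powr qs * B powr qs * K powr (qs * qs)) *
      centered_maximal nu (\<lambda>y. ennreal (g F y)) x epowr \<tau>"
    (is "(?I / _) epowr _ \<le> _")
proof (cases "measure nu (cube x l) = 0")
  case True
  then have "?I = 0"
    by (intro nu_null_imp_integral_zero) (auto simp: nu.emeasure_eq_measure)
  then show ?thesis
    using q(2)[OF x(1)] by (simp add: epowr_zero)
next
  case False
  define N m where "N = measure nu (cube x l)" and "m = measure \<mu> (cube x l)"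
  have N: "0 < N" using False by (simp add: N_def zero_less_measure_iff)
  have m_eq: "emeasure \<mu> (cube x l) = ennreal m"
    using cube_finite[OF x] by (simp add: m_def emeasure_eq_ennreal_measure)
  have "0 < m"
  proof (rule ccontr)
    assume "\<not> 0 < m"
    then have "emeasure \<mu> (cube x l) = 0" using m_eq by (simp add: ennreal_eq_0_iff)
    then have "cube x l \<inter> \<Omega> \<in> null_sets \<mu>"
      using emeasure_mono[of "cube x l \<inter> \<Omega>" "cube x l" \<mu>] by (intro null_setsI) auto
    then have "emeasure nu (cube x l) = 0"
      by (simp add: emeasure_nu nn_integral_null_set)
    with N show False by (simp add: N_def measure_def)
  qed
  obtain P where P: "ps \<le> P" "P \<le> p x" "\<And>y. y \<in> cube x l \<Longrightarrow> y \<in> \<Omega> \<Longrightarrow> P \<le> p y"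
    "(1 / m) powr (p x - P) \<le> K"
    using local_exponent[OF x] unfolding m_def by blast
  have P1: "1 < P" using P(1) ps(1) a_gt_1 by linarith
  have [measurable]: "g F \<in> borel_measurable \<mu>" using F by measurable
  have gm [measurable]: "g F \<in> borel_measurable nu"
    using F by (simp add: measurable_cong_sets[OF sets_nu refl])
  have bound: "(\<integral>\<^sup>+y\<in>cube x l. ennreal (g F y) \<partial>nu) \<le> ennreal (N powr (1 - 1 / \<tau>) * K0 powr (1 / \<tau>))"
  proof -
    have "(\<integral>\<^sup>+y\<in>cube x l. ennreal (g F y powr \<tau>) \<partial>nu) \<le> (\<integral>\<^sup>+y. ennreal (H F y powr p y) \<partial>nu)"
      by (intro nn_integral_mono) (auto simp: indicator_def g_powr)
    also note integral_H_le[OF F]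
    finally have "(\<integral>\<^sup>+y\<in>cube x l. ennreal ((g F y powr \<tau>) powr (1 / \<tau>)) \<partial>nu) \<le>
        ennreal (N powr (1 - 1 / \<tau>) * K0 powr (1 / \<tau>))"
      using \<tau>_gt_1 N K0_ge_1 by (intro Jensen_powr_nn_integral) (auto simp: N_def nu.emeasure_eq_measure)
    then show ?thesis using \<tau>_gt_1 g_nonneg by (simp add: powr_powr)
  qed
  define S where "S = enn2real (\<integral>\<^sup>+y\<in>cube x l. ennreal (g F y) \<partial>nu)"
  have S_eq: "(\<integral>\<^sup>+y\<in>cube x l. ennreal (g F y) \<partial>nu) = ennreal S"
    unfolding S_def using bound by (intro ennreal_enn2real[symmetric]) (auto simp: less_top[symmetric] top_unique)
  have S_le: "S \<le> N powr (1 - 1 / \<tau>) * K0 powr (1 / \<tau>)"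
    using bound unfolding S_eq by (simp add: ennreal_le_iff)
  have "ennreal N = (\<integral>\<^sup>+y\<in>cube x l. 1 \<partial>nu)"
    by (simp add: N_def nu.emeasure_eq_measure)
  also have "\<dots> \<le> ennreal S"
    unfolding S_eq[symmetric] using g_ge_1 by (intro nn_integral_nu_mono) auto
  finally have "N \<le> S" by (simp add: ennreal_le_iff2) (use N in linarith)
  with N have S: "0 < S" by simp
  have a\<tau>: "a * \<tau> = ps" using a_gt_1 by (simp add: \<tau>_def)
  have ps_pos: "0 < ps" using ps(1) a_gt_1 by linarith
  have "(\<integral>\<^sup>+y\<in>cube x l. ennreal (H F y powr a) \<partial>nu) \<le> (\<integral>\<^sup>+y\<in>cube x l. ennreal (g F y powr (a * \<tau> / P)) \<partial>nu)"
  proof (intro nn_integral_nu_mono ennreal_leI)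
    fix y assume y: "y \<in> cube x l" "y \<in> \<Omega>"
    have "1 \<le> p y / P" using P(3)[OF y] P1 by simp
    then have "a \<le> a * (p y / P)"
      using a_gt_1 mult_left_mono[of 1 "p y / P" a] by simp
    then have "H F y powr a \<le> H F y powr (a * (p y / P))"
      using H_ge_1 by (intro powr_mono) auto
    also have "\<dots> = g F y powr (a * \<tau> / P)"
      using \<tau>_gt_1 by (simp add: g_def powr_powr mult.commute)
    finally show "H F y powr a \<le> g F y powr (a * \<tau> / P)" .
  qed
  also have "\<dots> \<le> ennreal (N powr (1 - a * \<tau> / P) * S powr (a * \<tau> / P))"
    using S_eq N S g_nonneg P(1) P1 ps_pos
    by (intro Jensen_powr_nn_integral) (auto simp: a\<tau> N_def nu.emeasure_eq_measure)
  finally have "?I \<le> ennreal (A powr (1 / b) * m powr (1 - \<theta>) *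
      (N powr (- (1 / b)) * (N powr (1 - a * \<tau> / P) * S powr (a * \<tau> / P)) powr (1 / a)))"
    unfolding N_def m_def using N S F x by (intro fractional_average_le) (auto simp: N_def)
  also have "\<dots> \<le> ennreal (A powr (1 / b) * m powr (1 - \<theta>) * (K0 powr \<theta> * (S / N) powr (\<tau> * (1 / P - \<theta>))))"
    using N S S_le K0_ge_1 a_gt_1 P1 \<tau>_gt_1 \<theta> inverse_a
    by (intro ennreal_leI mult_left_mono mean_value_power_balance) auto
  finally have I1: "?I \<le> ennreal (A powr (1 / b) * m powr (1 - \<theta>) * (K0 powr \<theta> * (S / N) powr (\<tau> * (1 / P - \<theta>))))" .
  have I2: "?I \<le> ennreal B"
    using B(2) by (rule order_trans[rotated]) (auto intro!: nn_integral_mono simp: indicator_def)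
  define i where "i = enn2real ?I"
  have I_eq: "?I = ennreal i"
    unfolding i_def using I2 by (intro ennreal_enn2real[symmetric]) (auto simp: less_top[symmetric] top_unique)
  have "0 \<le> i" by (simp add: i_def)
  define R where "R = i / m powr (1 - \<theta>)"
  define Q where "Q = 1 / (1 / P - \<theta>)"
  have Q: "1 / Q = 1 / P - \<theta>" "\<tau> / Q = \<tau> * (1 / P - \<theta>)" by (simp_all add: Q_def)
  have R1: "R \<le> A powr (1 / b) * K0 powr \<theta> * (S / N) powr (\<tau> / Q)"
    using I1 \<open>0 < m\<close> unfolding I_eq R_def Q(2) by (simp add: ennreal_le_iff divide_le_eq mult_ac)
  have R2: "R \<le> B * (1 / m) powr (1 - \<theta>)"
    using I2 B(1) \<open>0 < m\<close> unfolding I_eq R_def by (simp add: ennreal_le_iff powr_divide divide_right_mono)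
  have C: "1 \<le> A powr (1 / b) * K0 powr \<theta>"
    using A K0_ge_1 b_pos \<theta> by (intro mult_ge1_I ge_one_powr_ge_zero) auto
  have Rq: "R powr q x \<le> (A powr (1 / b) * K0 powr \<theta>) powr qs * B powr qs * K powr (qs * qs) * (S / N) powr \<tau>"
  proof (rule exponent_at_center[where m = m and P = P and p = "p x" and Q = Q and \<theta> = \<theta>])
    show "0 \<le> R" using \<open>0 \<le> i\<close> by (simp add: R_def)
  qed (use R1 R2 C N S \<open>0 < m\<close> \<theta> P P1 Q(1) q x K B(1) in auto)
  have "ennreal (S / N) = (\<integral>\<^sup>+y\<in>cube x l. ennreal (g F y) \<partial>nu) / emeasure nu (cube x l)"
    using S N unfolding S_eq by (simp add: nu.emeasure_eq_measure divide_ennreal flip: N_def)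
  also have "\<dots> \<le> centered_maximal nu (\<lambda>y. ennreal (g F y)) x"
    unfolding centered_maximal_def using x(2) by (intro SUP_upper) auto
  finally have "ennreal (S / N) epowr \<tau> \<le> centered_maximal nu (\<lambda>y. ennreal (g F y)) x epowr \<tau>"
    using \<tau>_gt_1 by (intro epowr_mono) auto
  then have mean: "ennreal ((S / N) powr \<tau>) \<le> centered_maximal nu (\<lambda>y. ennreal (g F y)) x epowr \<tau>"
    using S N \<tau>_gt_1 by (simp add: epowr_ennreal)
  have "?I / (emeasure \<mu> (cube x l) epowr (1 - \<theta>)) = ennreal R"
    using \<open>0 < m\<close> \<open>0 \<le> i\<close> unfolding I_eq m_eq R_def
    by (simp add: epowr_pos_ennreal divide_ennreal)
  then have "(?I / (emeasure \<mu> (cube x l) epowr (1 - \<theta>))) epowr q x = ennreal (R powr q x)"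
    using q(2)[OF x(1)] \<open>0 \<le> i\<close> by (simp add: epowr_ennreal R_def)
  also have "\<dots> \<le> ennreal ((A powr (1 / b) * K0 powr \<theta>) powr qs * B powr qs * K powr (qs * qs)) *
      ennreal ((S / N) powr \<tau>)"
    using Rq by (simp add: ennreal_leI flip: ennreal_mult)
  also have "\<dots> \<le> ennreal ((A powr (1 / b) * K0 powr \<theta>) powr qs * B powr qs * K powr (qs * qs)) *
      centered_maximal nu (\<lambda>y. ennreal (g F y)) x epowr \<tau>"
    using mean by (intro mult_left_mono) auto
  finally show ?thesis .
qed

text \<open>The conclusion is stated through a measurable majorant \<open>U\<close>, so that constants can be taken out
  of the integral of \<open>U\<close>.\<close>

lemma weighted_modular_bound:
  obtains L where "1 \<le> L" "\<And>F. admissible F \<Longrightarrow>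
    \<exists>U\<in>borel_measurable \<mu>. (\<integral>\<^sup>+x\<in>\<Omega>. U x \<partial>\<mu>) \<le> ennreal L \<and> (\<forall>x\<in>\<Omega>. ennreal (V x) *
       (SUP l\<in>{0<..}. (\<integral>\<^sup>+y\<in>cube x l \<inter> \<Omega>. ennreal (F y) \<partial>\<mu>) / (emeasure \<mu> (cube x l) epowr (1 - \<theta>))) epowr q x
    \<le> U x)"
proof -
  obtain B where B: "1 \<le> B" "\<And>F. admissible F \<Longrightarrow> (\<integral>\<^sup>+y\<in>\<Omega>. ennreal (F y) \<partial>\<mu>) \<le> ennreal B"
    by (rule integral_bounded) blast
  define C where "C = (A powr (1 / b) * K0 powr \<theta>) powr qs * B powr qs * K powr (qs * qs)"
  define D where "D = 2 ^ CARD('n) * (2 powr (\<tau> - 1) / (2 powr (\<tau> - 1) - 1))"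
  define L where "L = C * (4 powr \<tau> * (measure nu \<Omega> + D * K0))"
  have "\<exists>U\<in>borel_measurable \<mu>. (\<integral>\<^sup>+x\<in>\<Omega>. U x \<partial>\<mu>) \<le> ennreal (max 1 L) \<and> (\<forall>x\<in>\<Omega>. ennreal (V x) *
       (SUP l\<in>{0<..}. (\<integral>\<^sup>+y\<in>cube x l \<inter> \<Omega>. ennreal (F y) \<partial>\<mu>) / (emeasure \<mu> (cube x l) epowr (1 - \<theta>))) epowr q x
    \<le> U x)" (is "\<exists>U\<in>_. _ \<and> (\<forall>x\<in>\<Omega>. _ * (?M x) epowr q x \<le> _)") if F: "admissible F" for F
  proof -
    let ?Mg = "\<lambda>x. centered_maximal nu (\<lambda>y. ennreal (g F y)) x"
    have [measurable]: "g F \<in> borel_measurable \<mu>" using F by measurable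
    then have gm: "g F \<in> borel_measurable nu"
      by (simp add: measurable_cong_sets[OF sets_nu refl])
    have "?Mg \<in> borel_measurable nu"
      by (rule nu.borel_measurable_of_borel, rule nu.borel_measurable_centered_maximal) (use gm in measurable)
    then have [measurable]: "?Mg \<in> borel_measurable \<mu>"
      by (simp add: measurable_cong_sets[OF sets_nu refl])
    have D: "0 \<le> D"
      using \<tau>_gt_1 by (auto simp: D_def ge_one_powr_ge_zero intro!: mult_nonneg_nonneg divide_nonneg_nonneg)
    have "?M x epowr q x \<le> ennreal C * ?Mg x epowr \<tau>" if x: "x \<in> \<Omega>" for x
    proof -
      have "?M x \<le> (ennreal C * ?Mg x epowr \<tau>) epowr (1 / q x)"
      proof (rule SUP_least)
        fix l :: real assume "l \<in> {0<..}"
        then show "(\<integral>\<^sup>+y\<in>cube x l \<inter> \<Omega>. ennreal (F y) \<partial>\<mu>) / (emeasure \<mu> (cube x l) epowr (1 - \<theta>))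
            \<le> (ennreal C * ?Mg x epowr \<tau>) epowr (1 / q x)"
          using fractional_average_power_le[OF x _ F B(1) B(2)[OF F], of l] q(2)[OF x]
          by (simp add: C_def flip: epowr_le_iff)
      qed
      then show ?thesis
        using q(2)[OF x] by (simp add: epowr_le_iff)
    qed
    then have "\<forall>x\<in>\<Omega>. ennreal (V x) * ?M x epowr q x \<le> ennreal (V x) * (ennreal C * ?Mg x epowr \<tau> * indicator \<Omega> x)"
      by (auto intro!: mult_left_mono)
    moreover have "(\<integral>\<^sup>+x\<in>\<Omega>. ennreal (V x) * (ennreal C * ?Mg x epowr \<tau> * indicator \<Omega> x) \<partial>\<mu>) \<le> ennreal (max 1 L)"
    proof -
      have "(\<integral>\<^sup>+x\<in>\<Omega>. ennreal (V x) * (ennreal C * ?Mg x epowr \<tau> * indicator \<Omega> x) \<partial>\<mu>) = (\<integral>\<^sup>+x. ennreal C * ?Mg x epowr \<tau> * indicator \<Omega> x \<partial>nu)"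
        by (rule nn_integral_nu[symmetric]) measurable
      also have "\<dots> = ennreal C * (\<integral>\<^sup>+x\<in>\<Omega>. ?Mg x epowr \<tau> \<partial>nu)"
        by (simp add: mult.assoc nn_integral_cmult)
      also have "\<dots> \<le> ennreal C * (ennreal (4 powr \<tau>) * (emeasure nu \<Omega> + ennreal D * (\<integral>\<^sup>+y. ennreal (g F y powr \<tau>) \<partial>nu)))"
        unfolding D_def
        using gm g_nonneg bounded_Omega \<tau>_gt_1 by (intro mult_left_mono nu.centered_maximal_strong_type) auto
      also have "\<dots> \<le> ennreal C * (ennreal (4 powr \<tau>) * (ennreal (measure nu \<Omega>) + ennreal D * ennreal K0))"
        using integral_H_le[OF F] by (intro mult_left_mono add_mono) (auto simp: g_powr nu.emeasure_eq_measure)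
      also have "\<dots> = ennreal L"
        using D K0_ge_1 by (simp add: L_def C_def flip: ennreal_mult ennreal_plus)
      also have "\<dots> \<le> ennreal (max 1 L)" by (intro ennreal_leI) auto
      finally show ?thesis .
    qed
    moreover have "(\<lambda>x. ennreal (V x) * (ennreal C * ?Mg x epowr \<tau> * indicator \<Omega> x)) \<in> borel_measurable \<mu>"
      by measurable
    ultimately show ?thesis
      by (intro bexI[of _ "\<lambda>x. ennreal (V x) * (ennreal C * ?Mg x epowr \<tau> * indicator \<Omega> x)"] conjI)
  qed
  then show ?thesis by (intro that[of "max 1 L"]) auto
qed

end

section \<open>Log-Hoelder exponents on cubes\<close>

text \<open>If \<open>\<Omega>\<close> has diameter zero, the hypothesis of lower regularity is void, but then \<open>\<Omega>\<close> is an atom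
  of \<open>\<mu>\<close>, whose mass bounds the measure of all cubes from below.\<close>

lemma lower_ahlfors_regular_small_cubes:
  fixes \<mu> :: "(real ^ 'n) measure"
  assumes borel: "sets borel \<subseteq> sets \<mu>" and \<Omega>: "\<Omega> \<in> sets \<mu>" "bounded \<Omega>" "emeasure \<mu> \<Omega> \<noteq> 0"
    and fin: "\<And>x l. x \<in> \<Omega> \<Longrightarrow> 0 < l \<Longrightarrow> emeasure \<mu> (cube x l) < \<infinity>"
    and reg: "lower_ahlfors_regular \<mu> \<beta> \<Omega>" and \<beta>: "0 < \<beta>"
  obtains c L where "0 < c" "0 < L"
    "\<And>x l. x \<in> \<Omega> \<Longrightarrow> 0 < l \<Longrightarrow> l \<le> L \<Longrightarrow> c * l powr \<beta> \<le> measure \<mu> (cube x l)"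
proof -
  have cube_sets: "cube x l \<in> sets \<mu>" for x l using borel cube_borel by blast
  have *: "r \<le> measure \<mu> (cube x l)" if "x \<in> \<Omega>" "0 < l" "0 \<le> r" "ennreal r \<le> emeasure \<mu> (cube x l)" for r x l
  proof -
    have "emeasure \<mu> (cube x l) = ennreal (measure \<mu> (cube x l))"
      using fin[OF that(1,2)] by (intro emeasure_eq_ennreal_measure) auto
    with that show ?thesis by (simp add: ennreal_le_iff)
  qed
  show ?thesis
  proof (cases "diameter \<Omega> = 0")
    case False
    then have "0 < diameter \<Omega>" using diameter_ge_0[OF \<Omega>(2)] by simp
    moreover obtain c where "0 < c"
      "\<And>x l. x \<in> \<Omega> \<Longrightarrow> 0 < l \<Longrightarrow> l < diameter \<Omega> \<Longrightarrow> ennreal (c * l powr \<beta>) \<le> emeasure \<mu> (cube x l)"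
      using reg unfolding lower_ahlfors_regular_def by blast
    ultimately show ?thesis
      by (intro that[of c "diameter \<Omega> / 2"] *) auto
  next
    case True
    define c where "c = measure \<mu> \<Omega>"
    have sub: "\<Omega> \<subseteq> cube x l" if "x \<in> \<Omega>" "0 < l" for x l
    proof
      fix y assume "y \<in> \<Omega>"
      then have "dist x y \<le> diameter \<Omega>" using that \<Omega>(2) by (intro diameter_bounded_bound)
      then have "y = x" using True by simp
      then show "y \<in> cube x l" using that by (simp add: center_in_cube)
    qed
    obtain x0 where x0: "x0 \<in> \<Omega>" using \<Omega>(3) by fastforce
    have "emeasure \<mu> \<Omega> \<le> emeasure \<mu> (cube x0 1)"
      using sub[OF x0, of 1] cube_sets by (intro emeasure_mono) auto
    then have "emeasure \<mu> \<Omega> < \<infinity>"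
      using fin[OF x0, of 1] by (simp add: order_le_less_trans)
    then have c: "emeasure \<mu> \<Omega> = ennreal c"
      unfolding c_def by (intro emeasure_eq_ennreal_measure) auto
    then have "0 < c" using \<Omega>(3) by (cases "c \<le> 0") (auto simp: ennreal_eq_0_iff)
    show ?thesis
    proof (rule that[of c 1])
      fix x :: "real ^ 'n" and l :: real
      assume xl: "x \<in> \<Omega>" "0 < l" "l \<le> 1"
      then have "c * l powr \<beta> \<le> c * 1"
        using \<open>0 < c\<close> \<beta> by (intro mult_left_mono powr_le1) auto
      moreover have "c \<le> measure \<mu> (cube x l)"
        using xl \<open>0 < c\<close> sub[of x l] cube_sets[of x l]
        by (intro *) (auto simp flip: c intro: emeasure_mono)
      ultimately show "c * l powr \<beta> \<le> measure \<mu> (cube x l)" by simp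
    qed (use \<open>0 < c\<close> in auto)
  qed
qed

lemma powr_le_max_one_powr:
  fixes t d e :: real
  assumes "0 \<le> d" "d \<le> e" "0 \<le> t" "t \<le> T"
  shows "t powr d \<le> max 1 T powr e"
proof -
  have "t powr d \<le> max 1 T powr d" using assms by (intro powr_mono2) auto
  also have "\<dots> \<le> max 1 T powr e" using assms by (intro powr_mono) auto
  finally show ?thesis .
qed

text \<open>On a small cube of side \<open>l\<close> the exponent oscillates by at most a multiple of \<open>1 / ln (1 / l)\<close>, and
  a power of \<open>1 / l\<close> with such an exponent is bounded.  On larger cubes the measure is bounded below.\<close>

lemma log_holder_local_exponent:
  fixes \<mu> :: "(real ^ 'n) measure"
  assumes reg: "0 < c" "0 < L" "\<And>x l. x \<in> \<Omega> \<Longrightarrow> 0 < l \<Longrightarrow> l \<le> L \<Longrightarrow> c * l powr \<beta> \<le> measure \<mu> (cube x l)"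
    and borel: "sets borel \<subseteq> sets \<mu>" and fin: "\<And>x l. x \<in> \<Omega> \<Longrightarrow> 0 < l \<Longrightarrow> emeasure \<mu> (cube x l) < \<infinity>"
    and \<beta>: "0 < \<beta>" and "log_holder \<Omega> p" and p: "0 \<le> ps" "\<And>x. x \<in> \<Omega> \<Longrightarrow> ps \<le> p x" "\<And>x. x \<in> \<Omega> \<Longrightarrow> p x \<le> pM"
  obtains K where "1 \<le> K" "\<And>x l. x \<in> \<Omega> \<Longrightarrow> 0 < l \<Longrightarrow>
      \<exists>P. ps \<le> P \<and> P \<le> p x \<and> (\<forall>y\<in>cube x l \<inter> \<Omega>. P \<le> p y) \<and> (1 / measure \<mu> (cube x l)) powr (p x - P) \<le> K"
proof -
  obtain C where C: "0 < C" "\<And>x y. x \<in> \<Omega> \<Longrightarrow> y \<in> \<Omega> \<Longrightarrow> dist x y \<le> 1 / 2 \<Longrightarrow>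
      \<bar>p x - p y\<bar> \<le> C / ln (1 / dist x y)"
    using \<open>log_holder \<Omega> p\<close> unfolding log_holder_def by blast
  define n where "n = real CARD('n)"
  have n: "1 \<le> n" by (simp add: n_def Suc_leI)
  \<comment> \<open>For \<open>l \<le> r\<close> the diameter of a cube of side \<open>l\<close> is at most \<open>n l \<le> 1/2\<close>, and \<open>(n l)\<^sup>2 \<le> l\<close>, whence
    \<open>ln (1 / l) \<le> 2 ln (1 / (n l))\<close>.\<close>
  define r where "r = min L (1 / (4 * n\<^sup>2))"
  have "1 \<le> n\<^sup>2" using n by simp
  have r: "0 < r" "r \<le> L" "r * (4 * n\<^sup>2) \<le> 1"
    using reg n by (auto simp: r_def min_def field_simps)
  have r4: "r \<le> 1 / 4"
  proof -
    have "r * 4 \<le> r * (4 * n\<^sup>2)" using r(1) \<open>1 \<le> n\<^sup>2\<close> by (intro mult_left_mono) auto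
    with r(3) show ?thesis by simp
  qed
  define K1 where "K1 = max 1 (1 / c) powr pM * exp (\<beta> * (2 * C))"
  define K2 where "K2 = max 1 (1 / (c * r powr \<beta>)) powr pM"
  have small: "\<exists>P. ps \<le> P \<and> P \<le> p x \<and> (\<forall>y\<in>cube x l \<inter> \<Omega>. P \<le> p y) \<and>
      (1 / measure \<mu> (cube x l)) powr (p x - P) \<le> K1" if x: "x \<in> \<Omega>" "0 < l" "l \<le> r" for x l
  proof -
    define \<epsilon> where "\<epsilon> = 2 * C / ln (1 / l)"
    define P where "P = max ps (p x - \<epsilon>)"
    have l: "l < 1" using x r4 by simp
    then have ln_pos: "0 < ln (1 / l)" using x by simp
    then have \<epsilon>: "0 < \<epsilon>" using C by (simp add: \<epsilon>_def)
    have "P \<le> p y" if y: "y \<in> cube x l" "y \<in> \<Omega>" for y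
    proof (cases "x = y")
      case True
      then show ?thesis using p x \<epsilon> by (simp add: P_def)
    next
      case False
      have "dist x y \<le> n * (l / 2)"
        unfolding n_def using y(1) by (rule cube_subset_cball)
      also have "\<dots> \<le> n * l" using n x by simp
      finally have d: "dist x y \<le> n * l" .
      have "(n * l)\<^sup>2 \<le> l"
      proof -
        have "(n * l)\<^sup>2 = l * (l * n\<^sup>2)" by (simp add: power2_eq_square)
        also have "\<dots> \<le> l * (r * (4 * n\<^sup>2))"
          using x \<open>1 \<le> n\<^sup>2\<close> by (intro mult_left_mono mult_mono) auto
        also have "\<dots> \<le> l * 1" using x r(3) by (intro mult_left_mono) auto
        finally show ?thesis by simp
      qed
      have "(n * l)\<^sup>2 \<le> (1 / 2)\<^sup>2"
      proof -
        have "(1 / 2)\<^sup>2 = (1 / 4 :: real)" by (simp add: power2_eq_square)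
        then show ?thesis using \<open>(n * l)\<^sup>2 \<le> l\<close> x r4 by linarith
      qed
      then have "n * l \<le> 1 / 2" by (rule power2_le_imp_le) simp
      have "ln (1 / l) \<le> ln (1 / (n * l)\<^sup>2)"
        using \<open>(n * l)\<^sup>2 \<le> l\<close> x n by (simp add: frac_le)
      also have "\<dots> = 2 * ln (1 / (n * l))"
        using x n by (simp add: ln_div ln_realpow)
      also have "ln (1 / (n * l)) \<le> ln (1 / dist x y)"
        using d False x n by (simp add: frac_le)
      finally have *: "ln (1 / l) \<le> 2 * ln (1 / dist x y)" by simp
      have "\<bar>p x - p y\<bar> \<le> C / ln (1 / dist x y)"
        using C(2) x y d \<open>n * l \<le> 1 / 2\<close> by force
      also have "\<dots> = 2 * C / (2 * ln (1 / dist x y))" by simp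
      also have "\<dots> \<le> \<epsilon>"
        unfolding \<epsilon>_def using * ln_pos C(1) by (intro divide_left_mono mult_pos_pos) auto
      finally show ?thesis using p y by (simp add: P_def)
    qed
    moreover have "(1 / measure \<mu> (cube x l)) powr (p x - P) \<le> K1"
    proof -
      have d: "0 \<le> p x - P" "p x - P \<le> \<epsilon>" "p x - P \<le> pM"
        using p(1) p(2,3)[OF x(1)] \<epsilon> unfolding P_def by linarith+
      have pos: "0 < c * l powr \<beta>" using reg(1) x by simp
      then have "1 / measure \<mu> (cube x l) \<le> 1 / (c * l powr \<beta>)"
        using reg(3)[OF x(1,2)] x(3) r(2) by (intro divide_left_mono) auto
      then have "(1 / measure \<mu> (cube x l)) powr (p x - P) \<le> (1 / c * (1 / l) powr \<beta>) powr (p x - P)"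
        using d x by (intro powr_mono2) (auto simp: powr_divide)
      also have "\<dots> = (1 / c) powr (p x - P) * (1 / l) powr (\<beta> * (p x - P))"
        by (simp only: powr_mult powr_powr)
      also have "\<dots> \<le> max 1 (1 / c) powr pM * exp (\<beta> * (2 * C))"
      proof (rule mult_mono)
        show "(1 / c) powr (p x - P) \<le> max 1 (1 / c) powr pM"
          using d reg(1) by (intro powr_le_max_one_powr) auto
        have "(p x - P) * ln (1 / l) \<le> \<epsilon> * ln (1 / l)"
          using d ln_pos by (intro mult_right_mono) auto
        also have "\<dots> = 2 * C" using ln_pos by (simp add: \<epsilon>_def)
        finally have "\<beta> * ((p x - P) * ln (1 / l)) \<le> \<beta> * (2 * C)"
          using \<beta> by (intro mult_left_mono) auto
        then show "(1 / l) powr (\<beta> * (p x - P)) \<le> exp (\<beta> * (2 * C))"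
          using x by (simp add: powr_def mult.assoc)
      qed auto
      finally show ?thesis by (simp add: K1_def)
    qed
    ultimately show ?thesis
      using p x \<epsilon> by (intro exI[of _ P]) (auto simp: P_def)
  qed
  have large: "(1 / measure \<mu> (cube x l)) powr (p x - ps) \<le> K2" if x: "x \<in> \<Omega>" "r < l" for x l
  proof -
    have pos: "0 < c * r powr \<beta>" using reg(1) r by simp
    have "c * r powr \<beta> \<le> measure \<mu> (cube x r)" using reg(3)[OF x(1) r(1,2)] .
    also have "\<dots> \<le> measure \<mu> (cube x l)"
      unfolding measure_def using x r fin[OF x(1), of l] cube_borel borel
      by (intro enn2real_mono emeasure_mono cube_mono) auto
    finally have "c * r powr \<beta> \<le> measure \<mu> (cube x l)" .
    then have "1 / measure \<mu> (cube x l) \<le> 1 / (c * r powr \<beta>)"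
      using pos reg(1) r(1) by (intro frac_le) auto
    then show ?thesis
      unfolding K2_def using p(1) p(2,3)[OF x(1)] by (intro powr_le_max_one_powr) auto
  qed
  show ?thesis
  proof (rule that[of "max 1 (max K1 K2)"])
    fix x :: "real ^ 'n" and l :: real assume x: "x \<in> \<Omega>" "0 < l"
    show "\<exists>P. ps \<le> P \<and> P \<le> p x \<and> (\<forall>y\<in>cube x l \<inter> \<Omega>. P \<le> p y) \<and>
        (1 / measure \<mu> (cube x l)) powr (p x - P) \<le> max 1 (max K1 K2)"
    proof (cases "l \<le> r")
      case True
      then show ?thesis using small[OF x True] by (auto simp: le_max_iff_disj)
    next
      case False
      then show ?thesis
        using large[of x l] p x by (intro exI[of _ ps]) (auto simp: le_max_iff_disj)
    qed
  qed auto
qed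

section \<open>Luxemburg norms\<close>

lemma e2ennreal_scaled: "0 < l \<Longrightarrow> e2ennreal \<bar>enn2ereal z / ereal l\<bar> = z / ennreal l"
  by (cases z) (auto simp: divide_ennreal ennreal_top_divide)

lemma lux_norm_le: "0 < l \<Longrightarrow> modular \<mu> p \<Omega> (\<lambda>x. f x / ereal l) \<le> 1 \<Longrightarrow> lux_norm \<mu> p \<Omega> f \<le> ennreal l"
  unfolding lux_norm_def by (intro Inf_lower) auto

lemma lux_norm_null_set:
  assumes "\<Omega> \<in> null_sets \<mu>"
  shows "lux_norm \<mu> p \<Omega> f = 0"
proof -
  have "modular \<mu> p \<Omega> g = 0" for g
    unfolding modular_def using assms by (rule nn_integral_null_set)
  then have "lux_norm \<mu> p \<Omega> f \<le> ennreal l" if "0 < l" for l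
    using that by (intro lux_norm_le) auto
  then show ?thesis
    by (metis ennreal_le_epsilon add_0 le_zero_eq zero_le)
qed

text \<open>A modular inequality on the unit ball is a norm inequality, by homogeneity.\<close>

lemma lux_norm_le_mult:
  assumes "1 \<le> C"
    and "\<And>l. 0 < l \<Longrightarrow> modular \<mu> p \<Omega> (\<lambda>x. f x / ereal l) \<le> 1 \<Longrightarrow>
      modular \<mu> q \<Omega> (\<lambda>x. h x / ereal (C * l)) \<le> 1"
  shows "lux_norm \<mu> q \<Omega> h \<le> ennreal C * lux_norm \<mu> p \<Omega> f"
proof -
  have "lux_norm \<mu> q \<Omega> h / ennreal C \<le> lux_norm \<mu> p \<Omega> f"
    unfolding lux_norm_def[of \<mu> p]
  proof (rule Inf_greatest, clarify)
    fix l :: real assume l: "0 < l" "modular \<mu> p \<Omega> (\<lambda>x. f x / ereal l) \<le> 1"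
    have "lux_norm \<mu> q \<Omega> h \<le> ennreal (C * l)"
      using assms l by (intro lux_norm_le) auto
    then show "lux_norm \<mu> q \<Omega> h / ennreal C \<le> ennreal l"
      using assms(1) l by (intro divide_le_posI_ennreal) (auto simp: ennreal_mult)
  qed
  then have "ennreal C * (lux_norm \<mu> q \<Omega> h / ennreal C) \<le> ennreal C * lux_norm \<mu> p \<Omega> f"
    by (rule mult_left_mono) simp
  moreover have "ennreal C * (lux_norm \<mu> q \<Omega> h / ennreal C) = lux_norm \<mu> q \<Omega> h"
    using assms(1) mult_divide_eq_ennreal[of "ennreal C" "lux_norm \<mu> q \<Omega> h"]
    by (simp add: ennreal_times_divide mult.commute ennreal_eq_0_iff)
  ultimately show ?thesis by simp
qed

section \<open>Weights\<close>

text \<open>Neither factor of the Muckenhoupt product vanishes unless \<open>\<mu> (Q \<inter> \<Omega>) = 0\<close>, so that a finite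
  product makes both factors finite.\<close>

lemma muckenhoupt_product_finite:
  fixes I J :: ennreal
  assumes "0 < M" "1 < \<sigma>" "I \<noteq> 0" "J \<noteq> 0"
    and le: "(I / ennreal M) * (J / ennreal M) epowr (\<sigma> - 1) \<le> ennreal C"
  obtains i j where "0 < i" "0 < j" "I = ennreal i" "J = ennreal j" "i * j powr (\<sigma> - 1) \<le> C * M powr \<sigma>"
proof -
  have J0: "(J / ennreal M) epowr (\<sigma> - 1) \<noteq> 0"
    using assms by (auto simp: epowr_def ennreal_divide_eq_0_iff enn2real_eq_0_iff ennreal_eq_0_iff)
  have "I \<noteq> top"
  proof
    assume "I = top"
    then have "(I / ennreal M) * (J / ennreal M) epowr (\<sigma> - 1) = top"
      using J0 by (simp add: ennreal_top_divide ennreal_top_mult)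
    with le show False by (simp add: top_unique)
  qed
  have "J \<noteq> top"
  proof
    assume "J = top"
    then have "(I / ennreal M) * (J / ennreal M) epowr (\<sigma> - 1) = top"
      using assms by (simp add: ennreal_top_divide epowr_top ennreal_mult_top)
    with le show False by (simp add: top_unique)
  qed
  obtain i j where ij: "I = ennreal i" "J = ennreal j" "0 < i" "0 < j"
    using \<open>I \<noteq> top\<close> \<open>J \<noteq> top\<close> assms by (cases I; cases J) (auto simp: less_le)
  have "ennreal (i / M * (j / M) powr (\<sigma> - 1)) \<le> ennreal C"
    using le ij \<open>0 < M\<close> by (simp add: divide_ennreal epowr_pos_ennreal flip: ennreal_mult)
  moreover have pos: "0 < i / M * (j / M) powr (\<sigma> - 1)" using ij \<open>0 < M\<close> by simp
  ultimately have "i / M * (j / M) powr (\<sigma> - 1) \<le> C"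
    by (metis ennreal_le_iff2 not_less)
  then have "i / M * (j / M) powr (\<sigma> - 1) * M powr \<sigma> \<le> C * M powr \<sigma>"
    by (rule mult_right_mono) simp
  moreover have "M powr \<sigma> = M * M powr (\<sigma> - 1)"
    using \<open>0 < M\<close> by (simp add: powr_diff)
  ultimately have "i * j powr (\<sigma> - 1) \<le> C * M powr \<sigma>"
    using \<open>0 < M\<close> ij by (simp add: powr_divide)
  with ij show ?thesis by (intro that)
qed

lemma weight_real_version:
  assumes w: "weight_on \<mu> \<Omega> w" and \<Omega>: "\<Omega> \<in> sets \<mu>" "space \<mu> = UNIV"
  obtains W :: "real ^ 'n \<Rightarrow> real" where "W \<in> borel_measurable \<mu>" "\<And>x. 0 < W x"
    "AE x in \<mu>. x \<in> \<Omega> \<longrightarrow> w x = ennreal (W x)"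
proof -
  define w1 where "w1 x = (if x \<in> \<Omega> then w x else 1)" for x
  have [measurable]: "w1 \<in> borel_measurable \<mu>"
    using w \<Omega> unfolding weight_on_def w1_def[abs_def] by (subst (asm) measurable_restrict_space_iff) auto
  define W where "W x = (if enn2real (w1 x) = 0 then 1 else enn2real (w1 x))" for x
  have "W \<in> borel_measurable \<mu>" unfolding W_def by measurable
  moreover have "0 < W x" for x by (simp add: W_def less_le)
  moreover have "AE x in \<mu>. x \<in> \<Omega> \<longrightarrow> 0 < w x \<and> w x < \<infinity>" using w by (simp add: weight_on_def)
  then have "AE x in \<mu>. x \<in> \<Omega> \<longrightarrow> w x = ennreal (W x)"
    by eventually_elim (auto simp: W_def w1_def enn2real_eq_0_iff)
  ultimately show ?thesis by (rule that)
qed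

theorem corollary1p8:
  fixes \<mu> :: "(real ^ 'n) measure"
    and \<Omega> :: "(real ^ 'n) set"
    and \<alpha> \<beta> \<delta> :: real
    and p p' q s :: "real ^ 'n \<Rightarrow> real"
    and w :: "real ^ 'n \<Rightarrow> ennreal"
  assumes "borel_regular \<mu>"
    and "\<And>x l. x \<in> \<Omega> \<Longrightarrow> 0 < l \<Longrightarrow> emeasure \<mu> (cube x l) < \<infinity>"
    and "bounded \<Omega>" and "\<Omega> \<in> sets \<mu>"
    and "lower_ahlfors_regular \<mu> \<beta> \<Omega>"
    and "0 \<le> \<alpha>" and "\<alpha> < \<beta>"
    and "exponent \<mu> \<Omega> p" and "log_holder \<Omega> p"
    and "1 < inf_on \<Omega> p"
    and "sup_on \<Omega> p < (if \<alpha> = 0 then \<infinity> else ereal (\<beta> / \<alpha>))"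
    and "\<And>x. x \<in> \<Omega> \<Longrightarrow> 1 / p x + 1 / p' x = 1"
    and "\<And>x. x \<in> \<Omega> \<Longrightarrow> 1 / q x = 1 / p x - \<alpha> / \<beta>"
    and "\<And>x. x \<in> \<Omega> \<Longrightarrow> s x = 1 + q x / p' x"
    and "weight_on \<mu> \<Omega> w"
    and "0 < \<delta>" and "\<delta> < inf_on \<Omega> s - 1"
    and "(\<lambda>x. w x epowr q x) \<in> A_class \<mu> (inf_on \<Omega> s - \<delta>) \<Omega>"
  shows "\<exists>C>0. \<forall>f :: real ^ 'n \<Rightarrow> ereal.
           (\<forall>x. x \<notin> \<Omega> \<longrightarrow> f x = 0) \<longrightarrow>
           (\<lambda>x. enn2ereal (w x) * f x) \<in> var_Lp \<mu> p \<Omega> \<longrightarrow>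
           lux_norm \<mu> q \<Omega> (\<lambda>x. enn2ereal (w x * frac_maximal \<mu> \<beta> \<alpha> f x))
             \<le> ennreal C * lux_norm \<mu> p \<Omega> (\<lambda>x. enn2ereal (w x) * f x)"
proof (cases "emeasure \<mu> \<Omega> = 0")
  case True
  then have "\<Omega> \<in> null_sets \<mu>" using assms(4) by auto
  then show ?thesis by (intro exI[of _ 1]) (simp add: lux_norm_null_set)
next
  case False
  have borel: "sets borel \<subseteq> sets \<mu>" and UNIV: "space \<mu> = UNIV"
    using assms(1) by (auto simp: borel_regular_def)
  note fin = assms(2) and [measurable] = \<open>\<Omega> \<in> sets \<mu>\<close>
  have [measurable, simp]: "cube x l \<in> sets \<mu>" for x l using borel cube_borel by blast
  obtain x0 where x0: "x0 \<in> \<Omega>" using False by fastforce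
  define \<theta> where "\<theta> = \<alpha> / \<beta>"
  have \<theta>: "0 \<le> \<theta>" "\<theta> < 1" and \<beta>: "0 < \<beta>" using assms(6,7) by (auto simp: \<theta>_def)

  have p1: "1 \<le> p x" if "x \<in> \<Omega>" for x using assms(8) that by (auto simp: exponent_def)
  have p_le: "ereal (p x) \<le> sup_on \<Omega> p" if "x \<in> \<Omega>" for x
    unfolding sup_on_def using that by (rule SUP_upper)
  have "sup_on \<Omega> p < \<infinity>"
    using assms(11) by (auto split: if_splits)
  then obtain pM where pM: "sup_on \<Omega> p = ereal pM"
    using p_le[OF x0] by (cases "sup_on \<Omega> p") auto
  have p_pM: "p x \<le> pM" if "x \<in> \<Omega>" for x using p_le[OF that] pM by simp
  have pM1: "1 \<le> pM" using p1[OF x0] p_pM[OF x0] by linarith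
  have \<theta>pM: "\<theta> < 1 / pM"
  proof (cases "\<alpha> = 0")
    case True
    then show ?thesis using pM1 by (simp add: \<theta>_def)
  next
    case False
    then have "pM < \<beta> / \<alpha>" "0 < \<alpha>" using assms(6,11) pM by auto
    then show ?thesis using pM1 \<beta> by (simp add: \<theta>_def field_simps)
  qed
  define qs where "qs = 1 / (1 / pM - \<theta>)"
  have q_inv: "1 / q x = 1 / p x - \<theta>" if "x \<in> \<Omega>" for x using assms(13)[OF that] by (simp add: \<theta>_def)
  have q_inv_ge: "1 / pM - \<theta> \<le> 1 / q x" if "x \<in> \<Omega>" for x
    unfolding q_inv[OF that] using p1[OF that] p_pM[OF that] by (intro diff_right_mono divide_left_mono) auto
  have q_pos: "0 < q x" if "x \<in> \<Omega>" for x
    using q_inv_ge[OF that] \<theta>pM by (metis diff_gt_0_iff_gt order_less_le_trans zero_less_divide_1_iff)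
  have q_eq: "q x = 1 / (1 / p x - \<theta>)" if "x \<in> \<Omega>" for x
    using q_inv[OF that] by (metis div_by_1 divide_divide_eq_right mult_1)
  have q_qs: "q x \<le> qs" if "x \<in> \<Omega>" for x
  proof -
    have "1 / (1 / q x) \<le> qs"
      unfolding qs_def using q_inv_ge[OF that] \<theta>pM by (intro frac_le) auto
    then show ?thesis by simp
  qed
  have q1: "1 \<le> q x" if "x \<in> \<Omega>" for x
  proof -
    have "1 / q x \<le> 1 / p x" using q_inv[OF that] \<theta> by simp
    also have "\<dots> \<le> 1" using p1[OF that] by simp
    finally show ?thesis using q_pos[OF that] by (simp add: divide_le_eq_1)
  qed

  \<comment> \<open>Since \<open>s = q (1 - \<theta>)\<close>, a gap between \<open>\<sigma>\<close> and \<open>s\<close> is one between the Hoelder exponent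
    \<open>a\<close> and \<open>p\<close>.\<close>
  have s_eq: "s x = q x * (1 - \<theta>)" if "x \<in> \<Omega>" for x
  proof -
    have "1 / p' x = 1 - 1 / p x" using assms(12)[OF that] by linarith
    also have "\<dots> = 1 - \<theta> - 1 / q x" using q_inv[OF that] by linarith
    finally have "q x * (1 / p' x) = q x * (1 - \<theta> - 1 / q x)" by simp
    then show ?thesis
      using assms(14)[OF that] q_pos[OF that] by (simp add: algebra_simps)
  qed
  define \<sigma> where "\<sigma> = inf_on \<Omega> s - \<delta>"
  have \<sigma>: "1 < \<sigma>" "\<sigma> < inf_on \<Omega> s" using assms(16,17) by (auto simp: \<sigma>_def)
  have s_ge: "inf_on \<Omega> s \<le> s x" if "x \<in> \<Omega>" for x
    unfolding inf_on_def using that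
  proof (rule cINF_lower[rotated])
    show "bdd_below (s ` \<Omega>)"
      using q_pos \<theta> by (intro bdd_belowI2[of _ 0]) (auto simp: s_eq less_imp_le)
  qed
  \<comment> \<open>\<open>ps\<close> is the value of \<open>p\<close> that corresponds to the value \<open>inf_on \<Omega> s\<close> of \<open>s\<close>.\<close>
  define ps where "ps = 1 / ((1 - \<theta>) / inf_on \<Omega> s + \<theta>)"
  have ps: "ps \<le> p x" if "x \<in> \<Omega>" for x
  proof -
    have "1 / p x = (1 - \<theta>) / s x + \<theta>"
      using q_inv[OF that] q_pos[OF that] \<theta> by (simp add: s_eq[OF that])
    also have "\<dots> \<le> (1 - \<theta>) / inf_on \<Omega> s + \<theta>"
      using s_ge[OF that] \<sigma> \<theta> by (intro add_right_mono divide_left_mono mult_pos_pos) auto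
    finally have *: "1 / p x \<le> (1 - \<theta>) / inf_on \<Omega> s + \<theta>" .
    have "ps \<le> 1 / (1 / p x)"
      unfolding ps_def using * p1[OF that] by (intro divide_left_mono mult_pos_pos) (auto intro: less_le_trans[of 0 "1 / p x"])
    then show ?thesis by simp
  qed
  have ps_gt: "1 / (1 / (\<sigma> / (1 - \<theta>)) + \<theta>) < ps"
  proof -
    have "(1 - \<theta>) / inf_on \<Omega> s < (1 - \<theta>) / \<sigma>"
      using \<sigma> \<theta> by (intro divide_strict_left_mono mult_pos_pos) auto
    moreover have "0 < (1 - \<theta>) / inf_on \<Omega> s" using \<sigma> \<theta> by simp
    ultimately show ?thesis
      unfolding ps_def using \<theta> by (intro divide_strict_left_mono mult_pos_pos) auto
  qed
  have "0 \<le> ps" unfolding ps_def using \<sigma> \<theta> by simp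

  \<comment> \<open>Values of the weight on a null set, and of weight and exponent off \<open>\<Omega>\<close>, do not affect the norms.
    So both may be taken finite, positive and measurable on the whole space.\<close>
  obtain W where W [measurable]: "W \<in> borel_measurable \<mu>" and W_pos: "\<And>x. 0 < W x"
    and w_W: "AE x in \<mu>. x \<in> \<Omega> \<longrightarrow> w x = ennreal (W x)"
    using weight_real_version[OF assms(15,4) UNIV] by metis
  define P where "P x = (if x \<in> \<Omega> then p x else 1)" for x
  have P [measurable]: "P \<in> borel_measurable \<mu>"
    using assms(8) UNIV unfolding exponent_def P_def[abs_def]
    by (subst (asm) measurable_restrict_space_iff[where c = 1]) auto
  define V where "V x = W x powr (1 / (1 / P x - \<theta>))" for x
  have V [measurable]: "V \<in> borel_measurable \<mu>" unfolding V_def by measurable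
  have V_pos: "0 < V x" for x using W_pos[of x] by (simp add: V_def)
  have V_eq: "V x = W x powr q x" if "x \<in> \<Omega>" for x
    using that q_eq[OF that] by (simp add: V_def P_def)
  have v_V: "AE x in \<mu>. x \<in> \<Omega> \<longrightarrow> w x epowr q x = ennreal (V x)"
    using w_W by eventually_elim (auto simp: V_eq epowr_pos_ennreal W_pos)

  define J where "J y = V y powr (- (1 / (\<sigma> - 1)))" for y
  have J [measurable]: "J \<in> borel_measurable \<mu>" unfolding J_def by measurable
  have J_pos: "0 < J x" for x using V_pos[of x] by (simp add: J_def)
  obtain A0 where A0: "\<And>x l. x \<in> \<Omega> \<Longrightarrow> 0 < l \<Longrightarrow>
        ((\<integral>\<^sup>+y\<in>cube x l \<inter> \<Omega>. (w y epowr q y) \<partial>\<mu>) / emeasure \<mu> (cube x l)) *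
        ((\<integral>\<^sup>+y\<in>cube x l \<inter> \<Omega>. ((w y epowr q y) epowr (- 1 / (\<sigma> - 1))) \<partial>\<mu>) / emeasure \<mu> (cube x l))
          epowr (\<sigma> - 1) \<le> ennreal A0"
    using assms(18) unfolding A_class_def \<sigma>_def by auto
  have Muck: "\<exists>i j. 0 < i \<and> 0 < j \<and> (\<integral>\<^sup>+y\<in>cube x l \<inter> \<Omega>. ennreal (V y) \<partial>\<mu>) = ennreal i \<and>
      (\<integral>\<^sup>+y\<in>cube x l \<inter> \<Omega>. ennreal (J y) \<partial>\<mu>) = ennreal j \<and>
      i * j powr (\<sigma> - 1) \<le> A0 * measure \<mu> (cube x l) powr \<sigma>"
    if x: "x \<in> \<Omega>" "0 < l" and pos: "emeasure \<mu> (cube x l \<inter> \<Omega>) \<noteq> 0" for x l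
  proof -
    let ?Q = "cube x l"
    have nz: "(\<integral>\<^sup>+y\<in>?Q \<inter> \<Omega>. ennreal (h y) \<partial>\<mu>) \<noteq> 0"
      if [measurable]: "h \<in> borel_measurable \<mu>" and h: "\<And>y. 0 < h y" for h
    proof
      assume "(\<integral>\<^sup>+y\<in>?Q \<inter> \<Omega>. ennreal (h y) \<partial>\<mu>) = 0"
      then have "AE y in \<mu>. ennreal (h y) * indicator (?Q \<inter> \<Omega>) y = 0"
        by (subst (asm) nn_integral_0_iff_AE) auto
      then have "AE y in \<mu>. y \<notin> ?Q \<inter> \<Omega>"
        by eventually_elim (use h in \<open>auto simp: indicator_def ennreal_eq_0_iff not_le[symmetric]\<close>)
      then show False using pos by (subst (asm) AE_iff_null_sets[symmetric]) auto
    qed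
    have I_eq: "(\<integral>\<^sup>+y\<in>?Q \<inter> \<Omega>. (w y epowr q y) \<partial>\<mu>) = (\<integral>\<^sup>+y\<in>?Q \<inter> \<Omega>. ennreal (V y) \<partial>\<mu>)"
      by (rule nn_integral_cong_AE) (use v_V in eventually_elim, auto simp: indicator_def)
    have J_eq: "(\<integral>\<^sup>+y\<in>?Q \<inter> \<Omega>. ((w y epowr q y) epowr (- 1 / (\<sigma> - 1))) \<partial>\<mu>) = (\<integral>\<^sup>+y\<in>?Q \<inter> \<Omega>. ennreal (J y) \<partial>\<mu>)"
      by (rule nn_integral_cong_AE)
        (use v_V in eventually_elim, auto simp: indicator_def J_def epowr_pos_ennreal V_pos)
    have "emeasure \<mu> ?Q = ennreal (measure \<mu> ?Q)"
      using fin[OF x] by (intro emeasure_eq_ennreal_measure) auto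
    moreover have "emeasure \<mu> ?Q \<noteq> 0"
      using pos emeasure_mono[of "?Q \<inter> \<Omega>" ?Q \<mu>] by auto
    ultimately have M: "emeasure \<mu> ?Q = ennreal (measure \<mu> ?Q)" "0 < measure \<mu> ?Q"
      by (auto simp: zero_less_measure_iff)
    show ?thesis
      using A0[OF x] unfolding I_eq J_eq M(1)
      by (rule muckenhoupt_product_finite[OF M(2) \<sigma>(1) nz[OF V V_pos] nz[OF J J_pos]]) blast
  qed
  obtain D where D: "0 < D" "\<Omega> \<subseteq> cube x0 D"
    using bounded_subset_cube[OF \<open>bounded \<Omega>\<close>] .
  then have D_eq: "cube x0 D \<inter> \<Omega> = \<Omega>" by blast
  interpret muckenhoupt_weight \<mu> \<Omega> V \<sigma> \<theta> "max 1 A0"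
  proof
    show "(\<integral>\<^sup>+x. ennreal (V x) * indicator \<Omega> x \<partial>\<mu>) < top"
      using Muck[OF x0 D(1)] False by (auto simp: D_eq)
    show "\<exists>Y\<ge>0. (\<integral>\<^sup>+y\<in>cube x l \<inter> \<Omega>. ennreal (V y powr (- (1 / (\<sigma> - 1)))) \<partial>\<mu>) \<le> ennreal Y \<and>
        enn2real (\<integral>\<^sup>+y\<in>cube x l \<inter> \<Omega>. ennreal (V y) \<partial>\<mu>) * Y powr (\<sigma> - 1)
          \<le> max 1 A0 * measure \<mu> (cube x l) powr \<sigma>" if x: "x \<in> \<Omega>" "0 < l" for x l
    proof (cases "emeasure \<mu> (cube x l \<inter> \<Omega>) = 0")
      case True
      then have "cube x l \<inter> \<Omega> \<in> null_sets \<mu>" by auto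
      then show ?thesis by (intro exI[of _ 0]) (simp add: nn_integral_null_set)
    next
      case False
      obtain i j where ij: "0 < i" "0 < j" "(\<integral>\<^sup>+y\<in>cube x l \<inter> \<Omega>. ennreal (V y) \<partial>\<mu>) = ennreal i"
          "(\<integral>\<^sup>+y\<in>cube x l \<inter> \<Omega>. ennreal (J y) \<partial>\<mu>) = ennreal j"
          "i * j powr (\<sigma> - 1) \<le> A0 * measure \<mu> (cube x l) powr \<sigma>"
        using Muck[OF x False] by blast
      have "A0 * measure \<mu> (cube x l) powr \<sigma> \<le> max 1 A0 * measure \<mu> (cube x l) powr \<sigma>"
        by (intro mult_right_mono) auto
      with ij show ?thesis by (intro exI[of _ j]) (auto simp flip: J_def)
    qed
  qed (use borel UNIV assms(3,4) fin V V_pos \<sigma> \<theta> in auto)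

  obtain c L where reg: "0 < c" "0 < L"
    "\<And>x l. x \<in> \<Omega> \<Longrightarrow> 0 < l \<Longrightarrow> l \<le> L \<Longrightarrow> c * l powr \<beta> \<le> measure \<mu> (cube x l)"
    using lower_ahlfors_regular_small_cubes[OF borel assms(4,3) False fin assms(5) \<beta>] by metis
  obtain K where K: "1 \<le> K" "\<And>x l. x \<in> \<Omega> \<Longrightarrow> 0 < l \<Longrightarrow>
      \<exists>P. ps \<le> P \<and> P \<le> p x \<and> (\<forall>y\<in>cube x l \<inter> \<Omega>. P \<le> p y) \<and> (1 / measure \<mu> (cube x l)) powr (p x - P) \<le> K"
    by (rule log_holder_local_exponent[OF reg borel fin \<beta> assms(9) \<open>0 \<le> ps\<close> ps p_pM]) blast+
  interpret variable_exponent_weight \<mu> \<Omega> V \<sigma> \<theta> "max 1 A0" P q ps qs K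
  proof
    show "a < ps" using ps_gt by (simp add: a_def b_def)
    show "\<exists>P'. ps \<le> P' \<and> P' \<le> P x \<and> (\<forall>y\<in>cube x l \<inter> \<Omega>. P' \<le> P y) \<and>
        (1 / measure \<mu> (cube x l)) powr (P x - P') \<le> K" if "x \<in> \<Omega>" "0 < l" for x l
      using K(2)[OF that] that(1) by (simp add: P_def)
  qed (use P ps q_inv q_pos q_qs K(1) in \<open>auto simp: P_def\<close>)

  obtain L where L: "1 \<le> L" "\<And>F. admissible F \<Longrightarrow>
    \<exists>U\<in>borel_measurable \<mu>. (\<integral>\<^sup>+x\<in>\<Omega>. U x \<partial>\<mu>) \<le> ennreal L \<and> (\<forall>x\<in>\<Omega>. ennreal (V x) *
       (SUP l\<in>{0<..}. (\<integral>\<^sup>+y\<in>cube x l \<inter> \<Omega>. ennreal (F y) \<partial>\<mu>) / (emeasure \<mu> (cube x l) epowr (1 - \<theta>))) epowr q x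
    \<le> U x)"
    by (rule weighted_modular_bound) blast
  have main: "modular \<mu> q \<Omega> (\<lambda>x. enn2ereal (w x * frac_maximal \<mu> \<beta> \<alpha> f x) / ereal (L * l)) \<le> 1"
    if f0: "\<forall>x. x \<notin> \<Omega> \<longrightarrow> f x = 0" and f: "(\<lambda>x. enn2ereal (w x) * f x) \<in> var_Lp \<mu> p \<Omega>"
      and l: "0 < l" and mod: "modular \<mu> p \<Omega> (\<lambda>x. enn2ereal (w x) * f x / ereal l) \<le> 1"
    for f :: "real ^ 'n \<Rightarrow> ereal" and l :: real
  proof -
    define h where "h x = enn2ereal (w x) * f x" for x
    have h [measurable]: "h \<in> borel_measurable \<mu>" using f unfolding h_def[abs_def] var_Lp_def by blast
    have h_fin: "AE x in \<mu>. x \<in> \<Omega> \<longrightarrow> \<bar>h x\<bar> \<noteq> \<infinity>"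
    proof -
      define S where "S = \<Omega> \<inter> {x \<in> space \<mu>. \<bar>h x\<bar> = \<infinity>}"
      have [measurable]: "S \<in> sets \<mu>" unfolding S_def by measurable
      have "top * emeasure \<mu> S = (\<integral>\<^sup>+x. top * indicator S x \<partial>\<mu>)"
        by (simp add: nn_integral_cmult_indicator)
      also have "\<dots> \<le> modular \<mu> p \<Omega> (\<lambda>x. enn2ereal (w x) * f x / ereal l)"
        unfolding modular_def
      proof (rule nn_integral_mono)
        fix x
        show "top * indicator S x \<le> e2ennreal \<bar>enn2ereal (w x) * f x / ereal l\<bar> epowr p x * indicator \<Omega> x"
        proof (cases "x \<in> S")
          case True
          then have "x \<in> \<Omega>" "\<bar>h x\<bar> = \<infinity>" by (auto simp: S_def)
          then have "\<bar>h x / ereal l\<bar> = \<infinity>" using l by (cases "h x") auto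
          then show ?thesis
            using \<open>x \<in> \<Omega>\<close> p1[OF \<open>x \<in> \<Omega>\<close>] by (simp add: h_def epowr_top)
        qed simp
      qed
      also note mod
      finally have "emeasure \<mu> S = 0"
        by (cases "emeasure \<mu> S = 0") (auto simp: ennreal_top_mult top_unique)
      then have "S \<in> null_sets \<mu>" by auto
      then have "AE x in \<mu>. x \<notin> S" by (rule AE_not_in)
      then show ?thesis by eventually_elim (auto simp: S_def UNIV)
    qed
    define F where "F x = (if x \<in> \<Omega> then \<bar>real_of_ereal (h x)\<bar> / (W x * l) else 0)" for x
    have F [measurable]: "F \<in> borel_measurable \<mu>" unfolding F_def by measurable
    have f_F: "AE x in \<mu>. x \<in> \<Omega> \<longrightarrow> e2ennreal \<bar>f x\<bar> = ennreal (l * F x) \<and>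
        e2ennreal \<bar>h x / ereal l\<bar> = ennreal (W x * F x)"
      using w_W h_fin
    proof eventually_elim
      case (elim x)
      show ?case
      proof
        assume x: "x \<in> \<Omega>"
        have h_x: "h x = ereal (W x) * f x"
          using elim(1) x W_pos[of x] by (simp add: h_def enn2ereal_ennreal)
        then obtain t where t: "f x = ereal t"
          using elim(2) x W_pos[of x] by (cases "f x") auto
        have "F x = \<bar>t\<bar> / l"
          using x t h_x W_pos[of x] l by (simp add: F_def abs_mult)
        then show "e2ennreal \<bar>f x\<bar> = ennreal (l * F x) \<and> e2ennreal \<bar>h x / ereal l\<bar> = ennreal (W x * F x)"
          using t h_x W_pos[of x] l by (simp add: abs_mult)
      qed
    qed
    have F_out: "F x = 0" if "x \<notin> \<Omega>" for x using that by (simp add: F_def)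
    have F0: "0 \<le> F x" for x
      unfolding F_def using W_pos[of x] l by (auto simp del: abs_real_of_ereal)
    have "(\<integral>\<^sup>+y\<in>\<Omega>. ennreal (V y * (F y * V y powr (- \<theta>)) powr P y) \<partial>\<mu>) =
        modular \<mu> p \<Omega> (\<lambda>x. enn2ereal (w x) * f x / ereal l)"
      unfolding modular_def
    proof (rule nn_integral_cong_AE, use f_F in eventually_elim)
      case (elim x)
      show ?case
      proof (cases "x \<in> \<Omega>")
        case True
        have "1 + - \<theta> * p x = p x * (1 / p x - \<theta>)"
          using p1[OF True] by (simp add: algebra_simps)
        also have "\<dots> = p x * (1 / q x)" using q_inv[OF True] by simp
        finally have "q x * (1 + - \<theta> * p x) = p x" using q_pos[OF True] by simp
        then have e: "q x * 1 + q x * (- \<theta> * p x) = p x" by (simp only: distrib_left)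
        have "V x * (F x * V x powr (- \<theta>)) powr p x = F x powr p x * (V x powr 1 * V x powr (- \<theta> * p x))"
          using V_pos[of x] by (simp add: powr_mult powr_powr)
        also have "V x powr 1 * V x powr (- \<theta> * p x) = W x powr p x"
          unfolding powr_add[symmetric] V_eq[OF True] powr_powr e ..
        also have "F x powr p x * W x powr p x = (W x * F x) powr p x"
          by (simp add: powr_mult)
        finally show ?thesis
          using True elim p1[OF True] W_pos[of x] F0[of x]
          by (simp add: P_def h_def epowr_ennreal)
      qed simp
    qed
    then have "admissible F"
      using mod F F0 by (simp add: admissible_def)
    then obtain U where U [measurable]: "U \<in> borel_measurable \<mu>" and U_le: "(\<integral>\<^sup>+x\<in>\<Omega>. U x \<partial>\<mu>) \<le> ennreal L"
      and U_ge: "\<And>x. x \<in> \<Omega> \<Longrightarrow> ennreal (V x) *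
       (SUP l\<in>{0<..}. (\<integral>\<^sup>+y\<in>cube x l \<inter> \<Omega>. ennreal (F y) \<partial>\<mu>) / (emeasure \<mu> (cube x l) epowr (1 - \<theta>))) epowr q x \<le> U x"
      using L(2) by blast
    have Mf: "frac_maximal \<mu> \<beta> \<alpha> f x = ennreal l *
        (SUP l\<in>{0<..}. (\<integral>\<^sup>+y\<in>cube x l \<inter> \<Omega>. ennreal (F y) \<partial>\<mu>) / (emeasure \<mu> (cube x l) epowr (1 - \<theta>)))" for x
    proof -
      have "(\<integral>\<^sup>+y\<in>cube x r. e2ennreal \<bar>f y\<bar> \<partial>\<mu>) = ennreal l * (\<integral>\<^sup>+y\<in>cube x r \<inter> \<Omega>. ennreal (F y) \<partial>\<mu>)" for r
      proof -
        have "(\<integral>\<^sup>+y\<in>cube x r. e2ennreal \<bar>f y\<bar> \<partial>\<mu>) = (\<integral>\<^sup>+y. ennreal l * (ennreal (F y) * indicator (cube x r \<inter> \<Omega>) y) \<partial>\<mu>)"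
          by (rule nn_integral_cong_AE)
            (use f_F in eventually_elim, use f0 F0 l in \<open>auto simp: indicator_def ennreal_mult e2ennreal_neg F_out\<close>)
        also have "\<dots> = ennreal l * (\<integral>\<^sup>+y\<in>cube x r \<inter> \<Omega>. ennreal (F y) \<partial>\<mu>)"
          by (intro nn_integral_cmult) measurable
        finally show ?thesis .
      qed
      then show ?thesis
        unfolding frac_maximal_def \<theta>_def by (simp add: SUP_mult_left_ennreal ennreal_times_divide)
    qed
    have "modular \<mu> q \<Omega> (\<lambda>x. enn2ereal (w x * frac_maximal \<mu> \<beta> \<alpha> f x) / ereal (L * l)) \<le>
        (\<integral>\<^sup>+x. ennreal (1 / L) * (U x * indicator \<Omega> x) \<partial>\<mu>)"
      unfolding modular_def
    proof (rule nn_integral_mono_AE, use w_W in eventually_elim)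
      case (elim x)
      define M where "M = (SUP l\<in>{0<..}. (\<integral>\<^sup>+y\<in>cube x l \<inter> \<Omega>. ennreal (F y) \<partial>\<mu>) /
        (emeasure \<mu> (cube x l) epowr (1 - \<theta>)))"
      have "e2ennreal \<bar>enn2ereal (w x * frac_maximal \<mu> \<beta> \<alpha> f x) / ereal (L * l)\<bar> epowr q x \<le> ennreal (1 / L) * U x"
        if x: "x \<in> \<Omega>"
      proof -
        have "e2ennreal \<bar>enn2ereal (w x * frac_maximal \<mu> \<beta> \<alpha> f x) / ereal (L * l)\<bar> =
            ennreal (W x) * (ennreal l * M) * ennreal (1 / (L * l))"
          using L(1) l elim x unfolding Mf M_def[symmetric]
          by (subst e2ennreal_scaled) (auto simp: divide_ennreal_def inverse_ennreal inverse_eq_divide)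
        also have "\<dots> = ennreal (W x * l * (1 / (L * l))) * M"
        proof -
          have "ennreal (W x * l * (1 / (L * l))) = ennreal (W x) * ennreal l * ennreal (1 / (L * l))"
            using ennreal_mult[of "W x * l" "1 / (L * l)"] ennreal_mult[of "W x" l] L(1) l W_pos[of x] by simp
          then show ?thesis by (simp only: mult_ac)
        qed
        also have "W x * l * (1 / (L * l)) = W x / L" using l by simp
        finally have "e2ennreal \<bar>enn2ereal (w x * frac_maximal \<mu> \<beta> \<alpha> f x) / ereal (L * l)\<bar> epowr q x =
            ennreal ((W x / L) powr q x) * M epowr q x"
          using q_pos[OF x] W_pos[of x] L(1) by (simp add: epowr_mult epowr_ennreal)
        also have "\<dots> \<le> ennreal (1 / L * V x) * M epowr q x"
        proof (intro mult_right_mono ennreal_leI)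
          have "L powr 1 \<le> L powr q x" using L(1) q1[OF x] by (intro powr_mono) auto
          then have "V x / L powr q x \<le> V x / L"
            using L(1) V_pos[of x] by (intro divide_left_mono) auto
          then show "(W x / L) powr q x \<le> 1 / L * V x"
            by (simp add: powr_divide V_eq[OF x])
        qed simp
        also have "\<dots> = ennreal (1 / L) * (ennreal (V x) * M epowr q x)"
          using L(1) V_pos[of x] by (simp add: ennreal_mult mult.assoc del: times_divide_eq_left)
        also have "\<dots> \<le> ennreal (1 / L) * U x"
          using U_ge[OF x] by (intro mult_left_mono) (auto simp: M_def)
        finally show ?thesis .
      qed
      then show ?case by (simp add: indicator_def)
    qed
    also have "\<dots> = ennreal (1 / L) * (\<integral>\<^sup>+x\<in>\<Omega>. U x \<partial>\<mu>)"
      by (intro nn_integral_cmult) measurable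
    also have "\<dots> \<le> ennreal (1 / L) * ennreal L"
      using U_le by (rule mult_left_mono) simp
    also have "\<dots> = 1"
      using L(1) by (simp flip: ennreal_mult)
    finally show ?thesis .
  qed
  show ?thesis
  proof (intro exI[of _ L] conjI allI impI)
    fix f :: "real ^ 'n \<Rightarrow> ereal"
    assume "\<forall>x. x \<notin> \<Omega> \<longrightarrow> f x = 0" "(\<lambda>x. enn2ereal (w x) * f x) \<in> var_Lp \<mu> p \<Omega>"
    then show "lux_norm \<mu> q \<Omega> (\<lambda>x. enn2ereal (w x * frac_maximal \<mu> \<beta> \<alpha> f x))
        \<le> ennreal L * lux_norm \<mu> p \<Omega> (\<lambda>x. enn2ereal (w x) * f x)"
      using L(1) by (intro lux_norm_le_mult main) auto
  qed (use L(1) in auto)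
qed

end
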